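(* Let $p>1$ and let $[X,\mathcal B,m^1,\nu_1]$, $[X,\mathcal B,m^2,\nu_2]$ be two reversible random walk spaces on the same measurable space with $\nu_2\ll\nu_1$, $\mu:=\frac{d\nu_2}{d\nu_1}\in L^\infty(X,\nu_1)$, and suppose there is $c>0$ with $\mu\ge c$ $\nu_1$-a.e. Assume either (a) $\nu_1(X)<\infty$, or (b) $\nu_1(X)=+\infty$ and $p\ge2$. Then, with $H=L^2(X,\nu_1)$, $$\partial_H\big(\mathcal F_{1,m^1}+\mathcal F_{p,m^2}\big)=-\Delta_1^{m^1}-\mu\Delta_p^{m^2}.$$ Moreover, this operator is completely accretive in $H$ and has dense domain in $H$.
   Context: A random walk space $[X,\mathcal B,m,\nu]$ consists of a measurable space $(X,\mathcal B)$ with $\mathcal B$ countably generated, a family $m=(m_x)_{x\in X}$ of probability measures on $\mathcal B$ with $x\mapsto m_x(B)$ measurable for each $B$, and a $\sigma$-finite measure $\nu$ with $\nu(A)=\int_X m_x(A)\,d\nu(x)$ for all $A$; it is reversible if $dm_x(y)\,d\nu(x)=dm_y(x)\,d\nu(y)$. $\nu\otimes m_x$ is the measure on $X\times X$ with $(\nu\otimes m_x)(A\times B)=\int_A m_x(B)\,d\nu(x)$; $\nabla u(x,y)=u(y)-u(x)$. On $H=L^2(X,\nu_1)$ (note $H\subset L^2(X,\nu_2)$ since $\mu$ is bounded): $\mathcal F_{1,m^1}(u)=\frac12\int_{X\times X}|\nabla u|\,d(\nu_1\otimes m^1_x)$ and $\mathcal F_{p,m^2}(u)=\frac1{2p}\int_{X\times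 X}|\nabla u|^p\,d(\nu_2\otimes m^2_x)$, each set to $+\infty$ when the integral is infinite. For a proper convex $\mathcal F$ on a Hilbert space $H$, $\partial_H\mathcal F(u)=\{v\in H:\mathcal F(w)-\mathcal F(u)\ge(v,w-u)\ \forall w\in H\}$. In a random walk space $[X,\mathcal B,m,\nu]$: $(u,v)\in\Delta_1^m$ iff $(u,-v)\in\partial_{L^2(X,\nu)}\mathcal F_{1,m}(u)$, where $\mathcal F_{1,m}(u)=\frac12\int|\nabla u|\,d(\nu\otimes m_x)$; and for $p>1$, $(u,v)\in\Delta_p^m$ iff $u,v\in L^2(X,\nu)$, $\nabla u\in L^p(\nu\otimes m_x)$ and $v(x)=\int_X|\nabla u(x,y)|^{p-2}\nabla u(x,y)\,dm_x(y)$. The operator $-\Delta_1^{m^1}-\mu\Delta_p^{m^2}$ on $H$ is the set of pairs $(u,v)$, $u,v\in H$, such that $v=v_1+v_2$ with $(u,-v_1)\in\Delta_1^{m^1}$ (in $[X,\mathcal B,m^1,\nu_1]$) and $v_2=-\mu w$ with $(u,w)\in\Delta_p^{m^2}$ (in $[X,\mathcal B,m^2,\nu_2]$). Complete accretivity of $A\subset H\times H$: for all $\lambda>0$ and $(u_1,v_1),(u_2,v_2)\in A$, $\int j(u_1-u_2)\,d\nu_1\le\int j(u_1-u_2+\lambda(v_1-v_2))\,d\nu_1$ for every convex lower semicontinuous $j:\mathbb R\to[0,\infty]$ with $j(0)=0$. *)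

theory Defs
  imports "HOL-Probability.Probability"
begin

text \<open>Random walk space [X,B,m,nu]; X = space nu, B = sets nu.\<close>
definition rws :: "('a \<Rightarrow> 'a measure) \<Rightarrow> 'a measure \<Rightarrow> bool" where
  "rws m \<nu> \<longleftrightarrow>
     (\<exists>C. countable C \<and> sets \<nu> = sigma_sets (space \<nu>) C) \<and>
     (\<forall>x\<in>space \<nu>. prob_space (m x) \<and> sets (m x) = sets \<nu>) \<and>
     (\<forall>B\<in>sets \<nu>. (\<lambda>x. emeasure (m x) B) \<in> borel_measurable \<nu>) \<and>
     sigma_finite_measure \<nu> \<and>
     (\<forall>A\<in>sets \<nu>. emeasure \<nu> A = (\<integral>\<^sup>+ x. emeasure (m x) A \<partial>\<nu>))"

text \<open>Reversibility: dm_x(y) dnu(x) = dm_y(x) dnu(y), tested on rectangles A x B.\<close>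
definition reversible :: "('a \<Rightarrow> 'a measure) \<Rightarrow> 'a measure \<Rightarrow> bool" where
  "reversible m \<nu> \<longleftrightarrow>
     (\<forall>A\<in>sets \<nu>. \<forall>B\<in>sets \<nu>.
        (\<integral>\<^sup>+ x. indicator A x * emeasure (m x) B \<partial>\<nu>) =
        (\<integral>\<^sup>+ x. indicator B x * emeasure (m x) A \<partial>\<nu>))"

definition sqint :: "'a measure \<Rightarrow> ('a \<Rightarrow> real) \<Rightarrow> bool" where
  "sqint \<nu> u \<longleftrightarrow> u \<in> borel_measurable \<nu> \<and> integrable \<nu> (\<lambda>x. (u x)\<^sup>2)"

text \<open>Integral with respect to nu (x) m_x, written out as the iterated integral.\<close>
definition F1 :: "('a \<Rightarrow> 'a measure) \<Rightarrow> 'a measure \<Rightarrow> ('a \<Rightarrow> real) \<Rightarrow> ereal" where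
  "F1 m \<nu> u = enn2ereal (ennreal (1/2) *
      (\<integral>\<^sup>+ x. (\<integral>\<^sup>+ y. ennreal \<bar>u y - u x\<bar> \<partial>(m x)) \<partial>\<nu>))"

definition Fp :: "real \<Rightarrow> ('a \<Rightarrow> 'a measure) \<Rightarrow> 'a measure \<Rightarrow> ('a \<Rightarrow> real) \<Rightarrow> ereal" where
  "Fp p m \<nu> u = enn2ereal (ennreal (1/(2*p)) *
      (\<integral>\<^sup>+ x. (\<integral>\<^sup>+ y. ennreal (\<bar>u y - u x\<bar> powr p) \<partial>(m x)) \<partial>\<nu>))"

definition subdiff :: "'a measure \<Rightarrow> (('a \<Rightarrow> real) \<Rightarrow> ereal) \<Rightarrow> ('a \<Rightarrow> real) \<Rightarrow> ('a \<Rightarrow> real) \<Rightarrow> bool" where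
  "subdiff \<nu> F u v \<longleftrightarrow> sqint \<nu> u \<and> sqint \<nu> v \<and> F u \<noteq> \<infinity> \<and>
     (\<forall>w. sqint \<nu> w \<longrightarrow> F u + ereal (\<integral>x. v x * (w x - u x) \<partial>\<nu>) \<le> F w)"

definition Delta1 :: "('a \<Rightarrow> 'a measure) \<Rightarrow> 'a measure \<Rightarrow> ('a \<Rightarrow> real) \<Rightarrow> ('a \<Rightarrow> real) \<Rightarrow> bool" where
  "Delta1 m \<nu> u v \<longleftrightarrow> subdiff \<nu> (F1 m \<nu>) u (\<lambda>x. - v x)"

definition Deltap :: "real \<Rightarrow> ('a \<Rightarrow> 'a measure) \<Rightarrow> 'a measure \<Rightarrow> ('a \<Rightarrow> real) \<Rightarrow> ('a \<Rightarrow> real) \<Rightarrow> bool" where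
  "Deltap p m \<nu> u v \<longleftrightarrow> sqint \<nu> u \<and> sqint \<nu> v \<and>
     (\<integral>\<^sup>+ x. (\<integral>\<^sup>+ y. ennreal (\<bar>u y - u x\<bar> powr p) \<partial>(m x)) \<partial>\<nu>) < \<infinity> \<and>
     (AE x in \<nu>. v x = (\<integral>y. \<bar>u y - u x\<bar> powr (p - 2) * (u y - u x) \<partial>(m x)))"

definition opA :: "real \<Rightarrow> ('a \<Rightarrow> 'a measure) \<Rightarrow> 'a measure \<Rightarrow> ('a \<Rightarrow> 'a measure) \<Rightarrow> 'a measure
     \<Rightarrow> ('a \<Rightarrow> real) \<Rightarrow> ('a \<Rightarrow> real) \<Rightarrow> ('a \<Rightarrow> real) \<Rightarrow> bool" where
  "opA p m1 \<nu>1 m2 \<nu>2 \<mu> u v \<longleftrightarrow> sqint \<nu>1 u \<and> sqint \<nu>1 v \<and>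
     (\<exists>v1 v2 w. v = (\<lambda>x. v1 x + v2 x) \<and> Delta1 m1 \<nu>1 u (\<lambda>x. - v1 x) \<and>
        Deltap p m2 \<nu>2 u w \<and> (AE x in \<nu>1. v2 x = - \<mu> x * w x))"

definition admissible_j :: "(real \<Rightarrow> ennreal) \<Rightarrow> bool" where
  "admissible_j j \<longleftrightarrow> j 0 = 0 \<and>
     (\<forall>x y t. 0 \<le> t \<and> t \<le> 1 \<longrightarrow>
        j (t * x + (1 - t) * y) \<le> ennreal t * j x + ennreal (1 - t) * j y) \<and>
     (\<forall>x. j x \<le> Liminf (at x) j)"

definition completely_accretive ::
  "'a measure \<Rightarrow> (('a \<Rightarrow> real) \<Rightarrow> ('a \<Rightarrow> real) \<Rightarrow> bool) \<Rightarrow> bool" where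
  "completely_accretive \<nu> A \<longleftrightarrow>
     (\<forall>lam>0. \<forall>u1 v1 u2 v2 j. A u1 v1 \<and> A u2 v2 \<and> admissible_j j \<longrightarrow>
        (\<integral>\<^sup>+ x. j (u1 x - u2 x) \<partial>\<nu>) \<le>
        (\<integral>\<^sup>+ x. j (u1 x - u2 x + lam * (v1 x - v2 x)) \<partial>\<nu>))"

definition dense_domain ::
  "'a measure \<Rightarrow> (('a \<Rightarrow> real) \<Rightarrow> ('a \<Rightarrow> real) \<Rightarrow> bool) \<Rightarrow> bool" where
  "dense_domain \<nu> A \<longleftrightarrow>
     (\<forall>f. sqint \<nu> f \<longrightarrow> (\<forall>\<epsilon>>0. \<exists>u v. A u v \<and> (\<integral>x. (f x - u x)\<^sup>2 \<partial>\<nu>) < \<epsilon>))"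

end

theory Submission
  imports Defs
begin

text \<open>
  The energies are integrals against the swap-invariant measure \<open>\<nu> \<otimes> m\<^sub>x\<close>, so for an antisymmetric
  field \<open>z\<close> one has \<open>\<integral> z \<nabla>\<phi> = - 2 \<integral> \<phi> (\<integral> z dm\<^sub>x) d\<nu>\<close>. Bounded functions with support of finite measure
  are dense enough: a soft-threshold truncation is a contraction, so it reaches every \<open>\<phi>\<close> in \<open>L\<^sup>2\<close>
  by dominated convergence.

  \<^item> If \<open>v\<close> is a subgradient of the sum at \<open>u\<close>, testing with \<open>u + t \<phi>\<close> and letting \<open>t\<close> tend to \<open>0\<close>
    gives \<open>\<integral> v\<^sub>1 \<phi> d\<nu>\<^sub>1 \<le> \<F>\<^sub>1(u + \<phi>) - \<F>\<^sub>1(u) \<le> \<integral> \<bar>\<phi>\<bar> d\<nu>\<^sub>1\<close> for \<open>v\<^sub>1 = v + \<mu> \<Delta>\<^sub>p u\<close>. Hence \<open>\<bar>v\<^sub>1\<bar> \<le> 1\<close>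
    almost everywhere, without any Hahn-Banach argument, and this bound is what puts \<open>\<Delta>\<^sub>p u\<close> into \<open>L\<^sup>2\<close>:
    at once if \<open>\<nu>\<^sub>1\<close> is finite, and for \<open>p \<ge> 2\<close> because \<open>\<Delta>\<^sub>p u\<close> lies in \<open>L\<^sup>1 + L\<^sup>2\<close>.
  \<^item> Complete accretivity: if \<open>h\<close> is nondecreasing and \<open>1\<close>-Lipschitz, replacing \<open>u\<^sub>1, u\<^sub>2\<close> by
    \<open>u\<^sub>1 - h(u\<^sub>1 - u\<^sub>2), u\<^sub>2 + h(u\<^sub>1 - u\<^sub>2)\<close> does not increase the sum of the two energies.
  \<^item> Density: every bounded function with support of finite measure lies in the domain, with
    \<open>x \<mapsto> - \<integral> sgn(u(y) - u(x)) dm\<^sub>x(y)\<close> as subgradient of \<open>\<F>\<^sub>1\<close>.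
\<close>

section \<open>The edge measure of a reversible random walk\<close>

definition grad :: "('a \<Rightarrow> real) \<Rightarrow> 'a \<times> 'a \<Rightarrow> real" where
  "grad u z = u (snd z) - u (fst z)"

lemma grad_swap: "grad u (prod.swap z) = - grad u z"
  by (simp add: grad_def)

lemma grad_add: "grad (\<lambda>x. u x + t * w x) z = grad u z + t * grad w z"
  by (simp add: grad_def algebra_simps)

lemma grad_diff: "grad (\<lambda>x. u x - w x) z = grad u z - grad w z"
  by (simp add: grad_def)

locale reversible_walk =
  fixes m :: "'a \<Rightarrow> 'a measure" and \<nu> :: "'a measure"
  assumes rws: "rws m \<nu>" and rev: "reversible m \<nu>"
begin

lemma prob_space_kernel: "x \<in> space \<nu> \<Longrightarrow> prob_space (m x)"
  and sets_kernel: "x \<in> space \<nu> \<Longrightarrow> sets (m x) = sets \<nu>"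
  and sigma_finite: "sigma_finite_measure \<nu>"
  and emeasure_kernel_measurable: "B \<in> sets \<nu> \<Longrightarrow> (\<lambda>x. emeasure (m x) B) \<in> borel_measurable \<nu>"
  and emeasure_invariant: "A \<in> sets \<nu> \<Longrightarrow> emeasure \<nu> A = (\<integral>\<^sup>+ x. emeasure (m x) A \<partial>\<nu>)"
  using rws by (auto simp: rws_def)

lemma kernel_measurable [measurable]: "m \<in> measurable \<nu> (subprob_algebra \<nu>)"
  using prob_space_kernel sets_kernel emeasure_kernel_measurable
  by (intro measurable_subprob_algebra) (auto intro: prob_space_imp_subprob_space)

lemma measurable_kernel_iff: "x \<in> space \<nu> \<Longrightarrow> measurable (m x) N = measurable \<nu> N"
  by (rule measurable_cong_sets) (auto simp: sets_kernel)

lemma space_kernel: "x \<in> space \<nu> \<Longrightarrow> space (m x) = space \<nu>"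
  by (rule sets_eq_imp_space_eq) (rule sets_kernel)

section \<open>The edge measure, its first marginal and its invariance under swapping\<close>

text \<open>This is the measure \<open>\<nu> \<otimes> m\<close>: each \<open>m x\<close> is pushed
  to the fibre over \<open>x\<close>, and \<open>bind\<close> integrates the results over
  \<open>\<nu>\<close>. The iterated integrals in \<open>F1\<close> and \<open>Fp\<close> thereby
  become single integrals.\<close>

definition P :: "('a \<times> 'a) measure" where
  "P = \<nu> \<bind> (\<lambda>x. distr (m x) (\<nu> \<Otimes>\<^sub>M \<nu>) (Pair x))"

lemma pair_kernel_measurable [measurable]:
  "(\<lambda>x. distr (m x) (\<nu> \<Otimes>\<^sub>M \<nu>) (Pair x)) \<in> measurable \<nu> (subprob_algebra (\<nu> \<Otimes>\<^sub>M \<nu>))"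
  by (rule measurable_distr2) measurable

lemma sets_P [measurable_cong]: "sets P = sets (\<nu> \<Otimes>\<^sub>M \<nu>)"
proof (cases "space \<nu> = {}")
  \<comment> \<open>On an empty space \<open>bind\<close> has the default value
    \<open>count_space {}\<close>, whose only measurable set is the empty one.\<close>
  case True
  then have "space (\<nu> \<Otimes>\<^sub>M \<nu>) = {}" by (simp add: space_pair_measure)
  then have "sets (\<nu> \<Otimes>\<^sub>M \<nu>) = {{}}"
    by (simp add: space_empty_iff)
  with True show ?thesis
    by (simp add: P_def bind_def)
next
  case False
  then show ?thesis
    unfolding P_def by (intro sets_bind) auto
qed

lemma space_P: "space P = space \<nu> \<times> space \<nu>"
  using sets_eq_imp_space_eq[OF sets_P] by (simp add: space_pair_measure)

lemma nn_integral_P: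
  assumes [measurable]: "f \<in> borel_measurable P"
  shows "(\<integral>\<^sup>+ z. f z \<partial>P) = (\<integral>\<^sup>+ x. \<integral>\<^sup>+ y. f (x, y) \<partial>m x \<partial>\<nu>)"
proof -
  have [measurable]: "f \<in> borel_measurable (\<nu> \<Otimes>\<^sub>M \<nu>)" by measurable
  have "(\<integral>\<^sup>+ z. f z \<partial>P) = (\<integral>\<^sup>+ x. \<integral>\<^sup>+ z. f z \<partial>distr (m x) (\<nu> \<Otimes>\<^sub>M \<nu>) (Pair x) \<partial>\<nu>)"
    unfolding P_def by (rule nn_integral_bind[where B="\<nu> \<Otimes>\<^sub>M \<nu>"]) measurable
  also have "\<dots> = (\<integral>\<^sup>+ x. \<integral>\<^sup>+ y. f (x, y) \<partial>m x \<partial>\<nu>)"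
    by (intro nn_integral_cong nn_integral_distr) (auto simp: measurable_kernel_iff)
  finally show ?thesis .
qed

lemma nn_integral_fst:
  assumes [measurable]: "f \<in> borel_measurable \<nu>"
  shows "(\<integral>\<^sup>+ z. f (fst z) \<partial>P) = (\<integral>\<^sup>+ x. f x \<partial>\<nu>)"
  by (subst nn_integral_P)
     (auto intro!: nn_integral_cong simp: prob_space.emeasure_space_1[OF prob_space_kernel])

lemma emeasure_P_times:
  assumes [measurable]: "A \<in> sets \<nu>" "B \<in> sets \<nu>"
  shows "emeasure P (A \<times> B) = (\<integral>\<^sup>+ x. indicator A x * emeasure (m x) B \<partial>\<nu>)"
proof -
  have [measurable]: "A \<times> B \<in> sets P" by simp
  have "emeasure P (A \<times> B) = (\<integral>\<^sup>+ z. indicator (A \<times> B) z \<partial>P)" by simp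
  also have "\<dots> = (\<integral>\<^sup>+ x. \<integral>\<^sup>+ y. indicator A x * indicator B y \<partial>m x \<partial>\<nu>)"
    by (subst nn_integral_P) (auto simp: indicator_times)
  also have "\<dots> = (\<integral>\<^sup>+ x. indicator A x * emeasure (m x) B \<partial>\<nu>)"
    by (intro nn_integral_cong, subst nn_integral_cmult)
       (auto simp: measurable_kernel_iff sets_kernel nn_integral_indicator)
  finally show ?thesis .
qed

lemma swap_measurable [measurable]: "prod.swap \<in> measurable P P"
  unfolding prod.swap_def[abs_def] by measurable

text \<open>Reversibility is given on rectangles. These form an intersection-stable generator, and
  strips over sets of finite measure exhaust the product, so the identity extends to all measurable
  sets of edges. Invariance of \<open>\<nu>\<close> makes the swapped strips finite as well.\<close>

lemma distr_swap_P: "distr P P prod.swap = P"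
proof -
  interpret sigma_finite_measure \<nu> by (rule sigma_finite)
  obtain F :: "nat \<Rightarrow> 'a set" where F: "range F \<subseteq> sets \<nu>" "(\<Union>i. F i) = space \<nu>"
      "\<And>i. emeasure \<nu> (F i) \<noteq> \<infinity>"
    using sigma_finite by metis
  let ?E = "{A \<times> B | A B. A \<in> sets \<nu> \<and> B \<in> sets \<nu>}"
  show ?thesis
  proof (rule measure_eqI_generator_eq[where A="\<lambda>i. F i \<times> space \<nu>"])
    show "Int_stable ?E" by (rule Int_stable_pair_measure_generator)
    show "?E \<subseteq> Pow (space \<nu> \<times> space \<nu>)" using sets.sets_into_space by blast
    show "sets (distr P P prod.swap) = sigma_sets (space \<nu> \<times> space \<nu>) ?E"
      "sets P = sigma_sets (space \<nu> \<times> space \<nu>) ?E"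
      by (simp_all add: sets_P sets_pair_measure)
    show "range (\<lambda>i. F i \<times> space \<nu>) \<subseteq> ?E" using F by blast
    show "(\<Union>i. F i \<times> space \<nu>) = space \<nu> \<times> space \<nu>" using F by blast
    fix X assume "X \<in> ?E"
    then obtain A B where X: "X = A \<times> B" and [measurable]: "A \<in> sets \<nu>" "B \<in> sets \<nu>" by auto
    have "prod.swap -` X \<inter> space P = B \<times> A"
      using sets.sets_into_space[of A \<nu>] sets.sets_into_space[of B \<nu>] by (auto simp: X space_P)
    then have "emeasure (distr P P prod.swap) X = emeasure P (B \<times> A)"
      by (subst emeasure_distr) (auto simp: X)
    also have "\<dots> = emeasure P X"
      using rev by (simp add: X emeasure_P_times reversible_def)
    finally show "emeasure (distr P P prod.swap) X = emeasure P X" .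
  next
    fix i
    have [measurable]: "F i \<in> sets \<nu>" using F by auto
    have "prod.swap -` (F i \<times> space \<nu>) \<inter> space P = space \<nu> \<times> F i"
      using sets.sets_into_space[of "F i" \<nu>] by (auto simp: space_P)
    then have "emeasure (distr P P prod.swap) (F i \<times> space \<nu>) = emeasure P (space \<nu> \<times> F i)"
      by (subst emeasure_distr) auto
    also have "\<dots> = emeasure \<nu> (F i)"
      by (subst emeasure_P_times) (auto simp: emeasure_invariant intro!: nn_integral_cong)
    finally show "emeasure (distr P P prod.swap) (F i \<times> space \<nu>) \<noteq> \<infinity>" using F by simp
  qed
qed

lemma integral_swap:
  fixes f :: "'a \<times> 'a \<Rightarrow> real"
  assumes [measurable]: "f \<in> borel_measurable P"
  shows "(\<integral> z. f (prod.swap z) \<partial>P) = (\<integral> z. f z \<partial>P)"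
  by (subst (2) distr_swap_P[symmetric], subst integral_distr) auto

lemma integrable_swap:
  fixes f :: "'a \<times> 'a \<Rightarrow> real"
  assumes "integrable P f"
  shows "integrable P (\<lambda>z. f (prod.swap z))"
proof -
  have [measurable]: "f \<in> borel_measurable P" using assms by auto
  have "integrable (distr P P prod.swap) f" using assms by (simp add: distr_swap_P)
  then show ?thesis by (subst (asm) integrable_distr_eq) auto
qed

lemma integrable_fst:
  fixes f :: "'a \<Rightarrow> real"
  assumes "integrable \<nu> f"
  shows "integrable P (\<lambda>z. f (fst z))"
proof -
  have [measurable]: "f \<in> borel_measurable \<nu>" using assms by auto
  show ?thesis
    using assms nn_integral_fst[of "\<lambda>x. ennreal \<bar>f x\<bar>"]
    by (auto simp: integrable_iff_bounded)
qed

lemma integrable_snd: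
  fixes f :: "'a \<Rightarrow> real"
  assumes "integrable \<nu> f"
  shows "integrable P (\<lambda>z. f (snd z))"
  using integrable_swap[OF integrable_fst[OF assms]] by simp

lemma grad_measurable [measurable]:
  assumes [measurable]: "u \<in> borel_measurable \<nu>"
  shows "grad u \<in> borel_measurable P"
  unfolding grad_def[abs_def] by measurable

section \<open>Disintegration of integrals over the edges\<close>

lemma integral_kernel_measurable:
  fixes f :: "'a \<times> 'a \<Rightarrow> real"
  assumes [measurable]: "f \<in> borel_measurable P"
  shows "(\<lambda>x. \<integral>y. f (x, y) \<partial>m x) \<in> borel_measurable \<nu>"
proof -
  have [measurable]: "f \<in> borel_measurable (\<nu> \<Otimes>\<^sub>M \<nu>)" by measurable
  have "(\<lambda>x. \<integral>z. f z \<partial>distr (m x) (\<nu> \<Otimes>\<^sub>M \<nu>) (Pair x)) \<in> borel_measurable \<nu>"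
    by measurable
  also have "?this \<longleftrightarrow> ?thesis"
    by (intro measurable_cong integral_distr) (auto simp: measurable_kernel_iff)
  finally show ?thesis .
qed

text \<open>Fubini's theorem for a kernel: \<open>nn_integral_P\<close> is applied to the positive
  and negative parts, whose inner integrals are finite almost everywhere.\<close>

lemma integrable_disintegrate:
  fixes f :: "'a \<times> 'a \<Rightarrow> real"
  assumes f: "integrable P f"
  shows "AE x in \<nu>. integrable (m x) (\<lambda>y. f (x, y))"
    and "integrable \<nu> (\<lambda>x. \<integral>y. f (x, y) \<partial>m x)"
    and "(\<integral>x. (\<integral>y. f (x, y) \<partial>m x) \<partial>\<nu>) = (\<integral>z. f z \<partial>P)"
proof -
  have fm [measurable]: "f \<in> borel_measurable P" using f by auto
  have [measurable]: "f \<in> borel_measurable (\<nu> \<Otimes>\<^sub>M \<nu>)" by measurable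
  \<comment> \<open>Used for the absolute value of \<open>f\<close>, for \<open>f\<close> and for
    \<open>- f\<close>. Since \<open>ennreal\<close> sends negative reals to 0, the last two are the
    positive and the negative part.\<close>
  have part: "AE x in \<nu>. (\<integral>\<^sup>+y. ennreal (g (x, y)) \<partial>m x) < \<infinity>"
      "integrable \<nu> (\<lambda>x. enn2real (\<integral>\<^sup>+y. ennreal (g (x, y)) \<partial>m x))"
      "(\<integral>x. enn2real (\<integral>\<^sup>+y. ennreal (g (x, y)) \<partial>m x) \<partial>\<nu>) = enn2real (\<integral>\<^sup>+z. ennreal (g z) \<partial>P)"
    if [measurable]: "g \<in> borel_measurable P" and g: "(\<integral>\<^sup>+z. ennreal (g z) \<partial>P) < \<infinity>" for g
  proof -
    have [measurable]: "g \<in> borel_measurable (\<nu> \<Otimes>\<^sub>M \<nu>)" by measurable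
    have eq: "(\<integral>\<^sup>+z. ennreal (g z) \<partial>P) = (\<integral>\<^sup>+x. \<integral>\<^sup>+y. ennreal (g (x, y)) \<partial>m x \<partial>\<nu>)"
      by (rule nn_integral_P) measurable
    have [measurable]: "(\<lambda>x. \<integral>\<^sup>+y. ennreal (g (x, y)) \<partial>m x) \<in> borel_measurable \<nu>"
      by (rule nn_integral_measurable_subprob_algebra2[where N=\<nu>]) measurable
    show fin: "AE x in \<nu>. (\<integral>\<^sup>+y. ennreal (g (x, y)) \<partial>m x) < \<infinity>"
      using g nn_integral_PInf_AE[of "\<lambda>x. \<integral>\<^sup>+y. ennreal (g (x, y)) \<partial>m x" \<nu>]
      by (auto simp: eq top.not_eq_extremum)
    have eq2: "(\<integral>\<^sup>+x. ennreal (enn2real (\<integral>\<^sup>+y. ennreal (g (x, y)) \<partial>m x)) \<partial>\<nu>) = (\<integral>\<^sup>+z. ennreal (g z) \<partial>P)"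
      unfolding eq using fin by (intro nn_integral_cong_AE) (auto elim!: eventually_mono)
    show "integrable \<nu> (\<lambda>x. enn2real (\<integral>\<^sup>+y. ennreal (g (x, y)) \<partial>m x))"
      using g by (intro integrableI_nonneg) (auto simp: eq2)
    show "(\<integral>x. enn2real (\<integral>\<^sup>+y. ennreal (g (x, y)) \<partial>m x) \<partial>\<nu>) = enn2real (\<integral>\<^sup>+z. ennreal (g z) \<partial>P)"
      by (subst integral_eq_nn_integral) (auto simp: eq2)
  qed
  have fin: "(\<integral>\<^sup>+z. ennreal \<bar>f z\<bar> \<partial>P) < \<infinity>"
    using f by (simp add: integrable_iff_bounded)
  have finp: "(\<integral>\<^sup>+z. ennreal (f z) \<partial>P) < \<infinity>" and finn: "(\<integral>\<^sup>+z. ennreal (- f z) \<partial>P) < \<infinity>"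
    by (rule le_less_trans[OF nn_integral_mono fin]; simp add: ennreal_leI)+
  show ae: "AE x in \<nu>. integrable (m x) (\<lambda>y. f (x, y))"
    using part(1)[OF _ fin, simplified] AE_space
  proof eventually_elim
    case (elim x)
    then have "(\<lambda>y. f (x, y)) \<in> borel_measurable (m x)" by (simp add: measurable_kernel_iff)
    with elim show ?case by (simp add: integrable_iff_bounded)
  qed
  have [measurable]: "(\<lambda>x. \<integral>y. f (x, y) \<partial>m x) \<in> borel_measurable \<nu>"
    by (rule integral_kernel_measurable) measurable
  have eq: "AE x in \<nu>. enn2real (\<integral>\<^sup>+y. ennreal (f (x, y)) \<partial>m x) -
      enn2real (\<integral>\<^sup>+y. ennreal (- f (x, y)) \<partial>m x) = (\<integral>y. f (x, y) \<partial>m x)"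
    using ae by eventually_elim (simp add: real_lebesgue_integral_def)
  note p = part[OF fm finp] and n = part[of "\<lambda>z. - f z", OF _ finn, simplified]
  have int: "integrable \<nu> (\<lambda>x. enn2real (\<integral>\<^sup>+y. ennreal (f (x, y)) \<partial>m x) -
      enn2real (\<integral>\<^sup>+y. ennreal (- f (x, y)) \<partial>m x))"
    using p n by (intro Bochner_Integration.integrable_diff) auto
  show "integrable \<nu> (\<lambda>x. \<integral>y. f (x, y) \<partial>m x)"
    using int by (rule integrable_cong_AE_imp) (use eq in \<open>auto elim!: eventually_mono\<close>)
  have "(\<integral>x. (\<integral>y. f (x, y) \<partial>m x) \<partial>\<nu>) = (\<integral>x. enn2real (\<integral>\<^sup>+y. ennreal (f (x, y)) \<partial>m x) -
      enn2real (\<integral>\<^sup>+y. ennreal (- f (x, y)) \<partial>m x) \<partial>\<nu>)"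
    using eq int by (intro integral_cong_AE) (auto elim!: eventually_mono)
  also have "\<dots> = (\<integral>z. f z \<partial>P)"
    using p n f by (simp add: real_lebesgue_integral_def)
  finally show "(\<integral>x. (\<integral>y. f (x, y) \<partial>m x) \<partial>\<nu>) = (\<integral>z. f z \<partial>P)" .
qed

end

section \<open>Truncation, powers and square-integrable functions\<close>

text \<open>Soft thresholding at \<open>1 / Suc n\<close> followed by clipping at
  \<open>Suc n\<close>. The threshold makes the support of a square-integrable function finite in
  measure, the clipping makes it bounded. A soft threshold, unlike a jump to 0, keeps the map a
  contraction.\<close>

definition trunc :: "nat \<Rightarrow> real \<Rightarrow> real" where
  "trunc n s = max (- real (Suc n)) (min (real (Suc n))
     (s - max (- (1 / real (Suc n))) (min (1 / real (Suc n)) s)))"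

lemma trunc_0 [simp]: "trunc n 0 = 0"
  by (simp add: trunc_def)

lemma trunc_lipschitz: "\<bar>trunc n s - trunc n t\<bar> \<le> \<bar>s - t\<bar>"
proof -
  define k l where "k = real (Suc n)" and "l = 1 / k"
  have "k > 0" "l > 0" by (auto simp: k_def l_def)
  then show ?thesis
    unfolding trunc_def k_def[symmetric] l_def[symmetric] by (auto simp: max_def min_def abs_if split: if_splits)
qed

lemma abs_trunc_le: "\<bar>trunc n s\<bar> \<le> \<bar>s\<bar>"
  using trunc_lipschitz[of n s 0] by simp

lemma abs_trunc_diff_le: "\<bar>s - trunc n s\<bar> \<le> \<bar>s\<bar>"
proof -
  define k l where "k = real (Suc n)" and "l = 1 / k"
  have "k > 0" "l > 0" by (auto simp: k_def l_def)
  then show ?thesis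
    unfolding trunc_def k_def[symmetric] l_def[symmetric] by (auto simp: max_def min_def abs_if)
qed

lemma abs_trunc_bounded: "\<bar>trunc n s\<bar> \<le> real (Suc n)"
  unfolding trunc_def by (auto simp: max_def min_def abs_if)

lemma trunc_nonzero_imp:
  assumes "trunc n s \<noteq> 0" shows "1 / real (Suc n) \<le> \<bar>s\<bar>"
proof -
  define k l where "k = real (Suc n)" and "l = 1 / k"
  have "k > 0" "l > 0" by (auto simp: k_def l_def)
  with assms show ?thesis
    unfolding trunc_def k_def[symmetric] l_def[symmetric] by (auto simp: max_def min_def abs_if split: if_splits)
qed

lemma trunc_measurable [measurable]: "trunc n \<in> borel_measurable borel"
  unfolding trunc_def[abs_def] by measurable

lemma trunc_LIMSEQ: "(\<lambda>n. trunc n s) \<longlonglongrightarrow> s"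
proof (rule Lim_null_comparison[where g="\<lambda>n. 1 / real (Suc n)", THEN LIM_zero_cancel])
  show "(\<lambda>n. 1 / real (Suc n)) \<longlonglongrightarrow> 0"
    using lim_1_over_n LIMSEQ_Suc by blast
  \<comment> \<open>Once \<open>n\<close> exceeds the absolute value of \<open>s\<close>, clipping
    no longer acts and at most the threshold \<open>1 / Suc n\<close> is lost.\<close>
  have "\<forall>\<^sub>F n in sequentially. \<bar>s\<bar> \<le> real n"
    using filterlim_real_sequentially by (simp add: filterlim_at_top)
  then show "\<forall>\<^sub>F n in sequentially. norm (trunc n s - s) \<le> 1 / real (Suc n)"
  proof eventually_elim
    case (elim n)
    define k l where "k = real (Suc n)" and "l = 1 / k"
    have "k > 0" "l > 0" "\<bar>s\<bar> \<le> k" using elim by (auto simp: k_def l_def)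
    then show ?case
      unfolding trunc_def k_def[symmetric] l_def[symmetric] by (auto simp: max_def min_def abs_if)
  qed
qed

section \<open>The \<open>p\<close>-flux and inequalities for \<open>p\<close>-th powers\<close>

text \<open>For \<open>p > 1\<close> the derivative of \<open>\<bar>s\<bar> powr p / p\<close>. The
  factor \<open>s\<close> gives the value 0 at the origin even when the exponent
  \<open>p - 2\<close> is negative.\<close>

definition pflux :: "real \<Rightarrow> real \<Rightarrow> real" where
  "pflux p s = \<bar>s\<bar> powr (p - 2) * s"

lemma abs_pflux: "\<bar>pflux p s\<bar> = \<bar>s\<bar> powr (p - 1)"
proof (cases "s = 0")
  case False
  have "\<bar>pflux p s\<bar> = \<bar>s\<bar> powr (p - 2) * \<bar>s\<bar> powr 1"
    by (simp add: pflux_def abs_mult)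
  also have "\<dots> = \<bar>s\<bar> powr (p - 1)" by (subst powr_add[symmetric]) simp
  finally show ?thesis .
qed (simp add: pflux_def)

lemma pflux_minus: "pflux p (- s) = - pflux p s"
  by (simp add: pflux_def)

lemma pflux_mult_self: "pflux p s * s = \<bar>s\<bar> powr p"
proof (cases "s = 0")
  case False
  have "pflux p s * s = \<bar>s\<bar> powr (p - 2) * \<bar>s\<bar> powr 2"
    using False by (simp add: pflux_def power2_eq_square)
  also have "\<dots> = \<bar>s\<bar> powr p" by (subst powr_add[symmetric]) simp
  finally show ?thesis .
qed (simp add: pflux_def)

lemma pflux_measurable [measurable]: "pflux p \<in> borel_measurable borel"
  unfolding pflux_def[abs_def] by measurable

text \<open>For \<open>p < 2\<close> the factor \<open>\<bar>s\<bar> powr (p - 2)\<close> blows up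
  near 0. Continuity there is read off from the absolute value
  \<open>\<bar>s\<bar> powr (p - 1)\<close>, whose exponent is positive.\<close>

lemma pflux_isCont:
  assumes "p > 1" shows "isCont (pflux p) s"
proof (cases "s = 0")
  case True
  have "((\<lambda>s::real. \<bar>s\<bar> powr (p - 1)) \<longlongrightarrow> \<bar>0\<bar> powr (p - 1)) (at 0)"
    using assms by (intro tendsto_powr' tendsto_intros) auto
  then have "((\<lambda>s. \<bar>pflux p s\<bar>) \<longlongrightarrow> 0) (at 0)" by (simp add: abs_pflux)
  then have "(pflux p \<longlongrightarrow> 0) (at 0)" by (rule tendsto_rabs_zero_cancel)
  then show ?thesis using True by (simp add: isCont_def pflux_def)
next
  case False
  then show ?thesis
    unfolding pflux_def[abs_def] by (intro continuous_intros) auto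
qed

text \<open>A crude form of Young's inequality: the product is at most the larger of the two powers.
  It serves as the integrable majorant for the flux times a function.\<close>

lemma powr_mult_abs_le:
  fixes a b :: real
  assumes "p \<ge> 1"
  shows "\<bar>a\<bar> powr (p - 1) * \<bar>b\<bar> \<le> \<bar>a\<bar> powr p + \<bar>b\<bar> powr p"
proof -
  have pw: "\<bar>c\<bar> powr (p - 1) * \<bar>c\<bar> = \<bar>c\<bar> powr p" for c :: real
    by (metis abs_ge_zero abs_mult abs_pflux abs_abs pflux_mult_self abs_of_nonneg powr_ge_zero)
  show ?thesis
  proof (cases "\<bar>b\<bar> \<le> \<bar>a\<bar>")
    case True
    then have "\<bar>a\<bar> powr (p - 1) * \<bar>b\<bar> \<le> \<bar>a\<bar> powr (p - 1) * \<bar>a\<bar>" by (intro mult_left_mono) auto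
    then show ?thesis using pw[of a] by (simp add: add_increasing2)
  next
    case False
    then have "\<bar>a\<bar> powr (p - 1) * \<bar>b\<bar> \<le> \<bar>b\<bar> powr (p - 1) * \<bar>b\<bar>"
      using assms by (intro mult_right_mono powr_mono2) auto
    then show ?thesis using pw[of b] by (simp add: add_increasing)
  qed
qed

text \<open>The sum is at most twice the larger modulus. This argument covers exponents below 1,
  which occur because the flux grows like the power \<open>p - 1\<close>.\<close>

lemma powr_abs_add_le:
  fixes a b :: real
  assumes "q \<ge> 0"
  shows "\<bar>a + b\<bar> powr q \<le> 2 powr q * (\<bar>a\<bar> powr q + \<bar>b\<bar> powr q)"
proof -
  have *: "\<bar>a + b\<bar> powr q \<le> 2 powr q * c powr q" if "c \<ge> \<bar>a\<bar>" "c \<ge> \<bar>b\<bar>" for c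
    using that assms powr_mono2[of q "\<bar>a + b\<bar>" "2 * c"] by (simp add: powr_mult)
  show ?thesis
  proof (cases "\<bar>a\<bar> \<le> \<bar>b\<bar>")
    case True
    show ?thesis
      by (rule order.trans[OF *[of "\<bar>b\<bar>"]]) (use True in \<open>auto intro!: mult_left_mono\<close>)
  next
    case False
    show ?thesis
      by (rule order.trans[OF *[of "\<bar>a\<bar>"]]) (use False in \<open>auto intro!: mult_left_mono\<close>)
  qed
qed

text \<open>The tangent line inequality of a convex function. It is derived from Young's inequality
  instead of differentiation, so that \<open>p = 1\<close> with its kink at 0 is covered.\<close>

lemma powr_abs_gradient_ineq:
  fixes a b :: real
  assumes "p \<ge> 1"
  shows "\<bar>a\<bar> powr p + p * (pflux p a * (b - a)) \<le> \<bar>b\<bar> powr p"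
proof -
  have young: "p * (\<bar>a\<bar> powr (p - 1) * \<bar>b\<bar>) \<le> (p - 1) * \<bar>a\<bar> powr p + \<bar>b\<bar> powr p"
  proof (cases "p = 1")
    case True
    then show ?thesis by (simp add: powr_def)
  next
    case False
    with assms have p: "p > 1" by simp
    define q where "q = p / (p - 1)"
    have q: "q > 1" "1 / p + 1 / q = 1" using p by (auto simp: q_def field_simps)
    have "\<bar>a\<bar> powr (p - 1) * \<bar>b\<bar> \<le> (\<bar>a\<bar> powr (p - 1)) powr q / q + \<bar>b\<bar> powr p / p"
      using p q by (intro Youngs_inequality) auto
    also have "(\<bar>a\<bar> powr (p - 1)) powr q = \<bar>a\<bar> powr p"
      using p by (simp add: powr_powr q_def)
    finally have "p * (\<bar>a\<bar> powr (p - 1) * \<bar>b\<bar>) \<le> p * (\<bar>a\<bar> powr p / q + \<bar>b\<bar> powr p / p)"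
      using p by (intro mult_left_mono) auto
    also have "\<dots> = (p - 1) * \<bar>a\<bar> powr p + \<bar>b\<bar> powr p"
      using p by (simp add: q_def field_simps)
    finally show ?thesis .
  qed
  have "pflux p a * b \<le> \<bar>a\<bar> powr (p - 1) * \<bar>b\<bar>"
    by (metis abs_ge_self abs_mult abs_pflux)
  then have "p * (pflux p a * b) \<le> p * (\<bar>a\<bar> powr (p - 1) * \<bar>b\<bar>)"
    using assms by (intro mult_left_mono) auto
  with young show ?thesis
    by (simp add: right_diff_distrib pflux_mult_self) (simp add: algebra_simps)
qed

text \<open>Averaging the tangent inequalities at the intermediate point \<open>c\<close> towards
  \<open>a\<close> and towards \<open>b\<close> cancels the linear terms.\<close>

lemma powr_abs_convex:
  fixes a b :: real
  assumes "p \<ge> 1" "0 \<le> s" "s \<le> 1"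
  shows "\<bar>(1 - s) * a + s * b\<bar> powr p \<le> (1 - s) * \<bar>a\<bar> powr p + s * \<bar>b\<bar> powr p"
proof -
  define c where "c = (1 - s) * a + s * b"
  have "(1 - s) * (\<bar>c\<bar> powr p + p * (pflux p c * (a - c))) + s * (\<bar>c\<bar> powr p + p * (pflux p c * (b - c)))
      \<le> (1 - s) * \<bar>a\<bar> powr p + s * \<bar>b\<bar> powr p"
    using assms by (intro add_mono mult_left_mono powr_abs_gradient_ineq) auto
  moreover have "(1 - s) * (\<bar>c\<bar> powr p + p * (pflux p c * (a - c))) + s * (\<bar>c\<bar> powr p + p * (pflux p c * (b - c)))
      = \<bar>c\<bar> powr p + p * pflux p c * ((1 - s) * a + s * b - c)"
    by (simp add: algebra_simps)
  ultimately show ?thesis by (simp add: c_def)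
qed

text \<open>With \<open>d\<close> between \<open>0\<close> and \<open>a - b\<close>, both \<open>a - d\<close> and \<open>b + d\<close> are convex combinations of \<open>a\<close>
  and \<open>b\<close> with exchanged weights.\<close>

lemma powr_abs_contract:
  fixes a b d :: real
  assumes "p \<ge> 1" and d: "0 \<le> d \<and> d \<le> a - b \<or> a - b \<le> d \<and> d \<le> 0"
  shows "\<bar>a - d\<bar> powr p + \<bar>b + d\<bar> powr p \<le> \<bar>a\<bar> powr p + \<bar>b\<bar> powr p"
proof (cases "a = b")
  case True
  with d show ?thesis by auto
next
  case False
  define s where "s = d / (a - b)"
  have s: "0 \<le> s" "s \<le> 1" using d False by (auto simp: s_def divide_simps)
  have ds: "d = s * (a - b)" using False by (simp add: s_def)
  have "a - d = (1 - s) * a + s * b" "b + d = (1 - s) * b + s * a"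
    unfolding ds by (simp_all add: algebra_simps)
  with powr_abs_convex[OF assms(1) s, of a b] powr_abs_convex[OF assms(1) s, of b a]
  show ?thesis by (simp add: algebra_simps)
qed

section \<open>Test functions and square-integrable functions\<close>

text \<open>The class of test functions: all their powers with nonnegative exponent are integrable,
  hence all their energies are finite, and the truncations of square-integrable functions belong to
  it.\<close>

definition bounded_finite_support :: "'a measure \<Rightarrow> ('a \<Rightarrow> real) \<Rightarrow> bool" where
  "bounded_finite_support \<nu> u \<longleftrightarrow> u \<in> borel_measurable \<nu> \<and> (\<exists>M. \<forall>x\<in>space \<nu>. \<bar>u x\<bar> \<le> M) \<and>
     emeasure \<nu> {x \<in> space \<nu>. u x \<noteq> 0} < \<infinity>"

lemma bounded_finite_support_measurable:
  "bounded_finite_support \<nu> u \<Longrightarrow> u \<in> borel_measurable \<nu>"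
  by (simp add: bounded_finite_support_def)

lemma bounded_finite_support_integrable:
  assumes "bounded_finite_support \<nu> u" and [measurable]: "f \<in> borel_measurable borel"
    and f: "f 0 = (0::real)" "\<And>x. \<bar>f x\<bar> \<le> g \<bar>x\<bar>" "\<And>x y. 0 \<le> x \<Longrightarrow> x \<le> y \<Longrightarrow> g x \<le> (g y :: real)"
  shows "integrable \<nu> (\<lambda>x. f (u x))"
proof -
  obtain M where M: "\<And>x. x \<in> space \<nu> \<Longrightarrow> \<bar>u x\<bar> \<le> M"
    and [measurable]: "u \<in> borel_measurable \<nu>" and fin: "emeasure \<nu> {x \<in> space \<nu>. u x \<noteq> 0} < \<infinity>"
    using assms(1) by (auto simp: bounded_finite_support_def)
  show ?thesis
  proof (rule integrableI_bounded_set[OF _ _ fin, where B="g M"])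
    show "AE x in \<nu>. x \<in> {x \<in> space \<nu>. u x \<noteq> 0} \<longrightarrow> norm (f (u x)) \<le> g M"
      using M f(2,3) by (auto intro!: AE_I2) (meson abs_ge_zero order_trans)
    show "AE x in \<nu>. x \<notin> {x \<in> space \<nu>. u x \<noteq> 0} \<longrightarrow> f (u x) = 0"
      using f by (auto intro!: AE_I2)
  qed measurable
qed

lemma bounded_finite_support_integrable_powr:
  assumes "bounded_finite_support \<nu> u" "q \<ge> 0"
  shows "integrable \<nu> (\<lambda>x. \<bar>u x\<bar> powr q)"
  by (rule bounded_finite_support_integrable[OF assms(1), where g="\<lambda>x. x powr q"])
     (use assms(2) in \<open>auto intro: powr_mono2\<close>)

lemma bounded_finite_support_integrable_abs:
  assumes "bounded_finite_support \<nu> u"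
  shows "integrable \<nu> (\<lambda>x. \<bar>u x\<bar>)"
  by (rule bounded_finite_support_integrable[OF assms(1), where g="\<lambda>x. x"]) auto

lemma bounded_finite_support_sqint:
  assumes "bounded_finite_support \<nu> u"
  shows "sqint \<nu> u"
  unfolding sqint_def
  by (intro conjI bounded_finite_support_measurable[OF assms]
      bounded_finite_support_integrable[OF assms, where g="\<lambda>x. x\<^sup>2"]) (auto intro: power_mono)

lemma sqint_measurable: "sqint \<nu> u \<Longrightarrow> u \<in> borel_measurable \<nu>"
  by (simp add: sqint_def)

lemma sqint_mult_integrable:
  assumes "sqint \<nu> u" "sqint \<nu> v" shows "integrable \<nu> (\<lambda>x. u x * v x)"
proof (rule Bochner_Integration.integrable_bound[where f="\<lambda>x. (u x)\<^sup>2 + (v x)\<^sup>2"])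
  have "\<bar>a * b\<bar> \<le> a\<^sup>2 + b\<^sup>2" for a b :: real
  proof -
    have "2 * \<bar>a * b\<bar> \<le> a\<^sup>2 + b\<^sup>2"
      using sum_squares_bound[of "\<bar>a\<bar>" "\<bar>b\<bar>"] by (simp add: abs_mult)
    then show ?thesis using abs_ge_zero[of "a * b"] by linarith
  qed
  then show "AE x in \<nu>. norm (u x * v x) \<le> norm ((u x)\<^sup>2 + (v x)\<^sup>2)"
    by auto
qed (use assms in \<open>auto simp: sqint_def\<close>)

lemma sqint_bound:
  assumes "integrable \<nu> g" and [measurable]: "u \<in> borel_measurable \<nu>" and "AE x in \<nu>. (u x)\<^sup>2 \<le> g x"
  shows "sqint \<nu> u"
  unfolding sqint_def
  by (intro conjI Bochner_Integration.integrable_bound[OF assms(1)]) (use assms(3) in auto)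

lemma sqint_add:
  assumes "sqint \<nu> u" "sqint \<nu> v" shows "sqint \<nu> (\<lambda>x. u x + v x)"
proof (rule sqint_bound[where g="\<lambda>x. 2 * (u x)\<^sup>2 + 2 * (v x)\<^sup>2"])
  have "(a + b)\<^sup>2 \<le> 2 * a\<^sup>2 + 2 * b\<^sup>2" for a b :: real
    using sum_squares_bound[of a b] by (simp add: power2_sum)
  then show "AE x in \<nu>. (u x + v x)\<^sup>2 \<le> 2 * (u x)\<^sup>2 + 2 * (v x)\<^sup>2" by auto
qed (use assms in \<open>auto simp: sqint_def\<close>)

lemma sqint_cmult:
  assumes "sqint \<nu> u" shows "sqint \<nu> (\<lambda>x. c * u x)"
  using assms by (auto simp: sqint_def power_mult_distrib)

lemma sqint_minus: "sqint \<nu> u \<Longrightarrow> sqint \<nu> (\<lambda>x. - u x)"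
  by (simp add: sqint_def)

lemma sqint_diff:
  assumes "sqint \<nu> u" "sqint \<nu> v" shows "sqint \<nu> (\<lambda>x. u x - v x)"
  using sqint_add[OF assms(1) sqint_minus[OF assms(2)]] by simp

lemma sqint_cong_AE:
  assumes "sqint \<nu> u" "v \<in> borel_measurable \<nu>" "AE x in \<nu>. v x = u x"
  shows "sqint \<nu> v"
  using assms by (intro sqint_bound[where g="\<lambda>x. (u x)\<^sup>2"]) (auto simp: sqint_def)

text \<open>The support lies where \<open>u\<close> is at least \<open>1 / Suc n\<close> in modulus,
  and Markov's inequality for the square of \<open>u\<close> bounds the measure of that set.\<close>

lemma trunc_bounded_finite_support:
  assumes "sqint \<nu> u" shows "bounded_finite_support \<nu> (\<lambda>x. trunc n (u x))"
proof -
  have [measurable]: "u \<in> borel_measurable \<nu>" using assms by (simp add: sqint_def)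
  define l where "l = 1 / real (Suc n)"
  have l: "l > 0" by (simp add: l_def)
  have "l\<^sup>2 \<le> (u x)\<^sup>2" if "trunc n (u x) \<noteq> 0" for x
    using trunc_nonzero_imp[OF that, folded l_def] l by (simp add: abs_le_square_iff[symmetric])
  then have "emeasure \<nu> {x \<in> space \<nu>. trunc n (u x) \<noteq> 0} \<le> emeasure \<nu> {x \<in> space \<nu>. l\<^sup>2 \<le> (u x)\<^sup>2}"
    by (intro emeasure_mono) auto
  also have "\<dots> = emeasure \<nu> {x \<in> space \<nu>. 1 \<le> ennreal (1 / l\<^sup>2) * ennreal ((u x)\<^sup>2)}"
    using l by (intro arg_cong2[where f=emeasure])
      (auto simp: ennreal_mult[symmetric] ennreal_1[symmetric] field_simps simp del: ennreal_1)
  also have "\<dots> \<le> ennreal (1 / l\<^sup>2) * (\<integral>\<^sup>+x. ennreal ((u x)\<^sup>2) * indicator (space \<nu>) x \<partial>\<nu>)"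
    using nn_integral_Markov_inequality[where u="\<lambda>x. ennreal ((u x)\<^sup>2)" and M=\<nu> and A="space \<nu>" and c="ennreal (1 / l\<^sup>2)"] by simp
  also have "\<dots> < \<infinity>"
    using assms by (simp add: sqint_def integrable_iff_bounded ennreal_mult_less_top)
  finally show ?thesis
    unfolding bounded_finite_support_def using abs_trunc_bounded by auto
qed

section \<open>Integration by parts and the energies\<close>

context reversible_walk
begin

text \<open>The gradient splits into its two endpoint terms. Swapping edges turns one into the
  other, with a sign from antisymmetry, so both contribute equally; this is the factor 2.\<close>

lemma integral_by_parts_bounded:
  assumes [measurable]: "\<phi> \<in> borel_measurable \<nu>" and [measurable]: "z \<in> borel_measurable P"
    and anti: "\<And>q. z (prod.swap q) = - z q"
    and int: "integrable P (\<lambda>q. z q * \<phi> (fst q))"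
  shows "integrable P (\<lambda>q. z q * grad \<phi> q)"
    and "integrable \<nu> (\<lambda>x. \<phi> x * (\<integral>y. z (x, y) \<partial>m x))"
    and "(\<integral>q. z q * grad \<phi> q \<partial>P) = - 2 * (\<integral>x. \<phi> x * (\<integral>y. z (x, y) \<partial>m x) \<partial>\<nu>)"
proof -
  have eq: "z q * grad \<phi> q = - (z (prod.swap q) * \<phi> (fst (prod.swap q))) - z q * \<phi> (fst q)" for q
    by (simp add: grad_def anti algebra_simps)
  have int': "integrable P (\<lambda>q. z (prod.swap q) * \<phi> (fst (prod.swap q)))"
    using integrable_swap[OF int] by simp
  show "integrable P (\<lambda>q. z q * grad \<phi> q)"
    unfolding eq by (intro Bochner_Integration.integrable_diff Bochner_Integration.integrable_minus int int')
  have inner: "(\<integral>y. z (x, y) * \<phi> x \<partial>m x) = \<phi> x * (\<integral>y. z (x, y) \<partial>m x)" for x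
    by (simp add: mult.commute)
  note dis = integrable_disintegrate[OF int, simplified inner fst_conv]
  show "integrable \<nu> (\<lambda>x. \<phi> x * (\<integral>y. z (x, y) \<partial>m x))" by (rule dis)
  have "(\<integral>q. z q * grad \<phi> q \<partial>P) =
      - (\<integral>q. z (prod.swap q) * \<phi> (fst (prod.swap q)) \<partial>P) - (\<integral>q. z q * \<phi> (fst q) \<partial>P)"
    unfolding eq using int int'
    by (subst Bochner_Integration.integral_diff) (auto intro!: Bochner_Integration.integrable_minus)
  also have "(\<integral>q. z (prod.swap q) * \<phi> (fst (prod.swap q)) \<partial>P) = (\<integral>q. z q * \<phi> (fst q) \<partial>P)"
    by (rule integral_swap[of "\<lambda>q. z q * \<phi> (fst q)"]) measurable
  finally show "(\<integral>q. z q * grad \<phi> q \<partial>P) = - 2 * (\<integral>x. \<phi> x * (\<integral>y. z (x, y) \<partial>m x) \<partial>\<nu>)"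
    by (simp add: dis(3))
qed

lemma abs_grad_trunc_le: "\<bar>grad (\<lambda>x. trunc n (\<phi> x)) q\<bar> \<le> \<bar>grad \<phi> q\<bar>"
  by (simp add: grad_def trunc_lipschitz)

lemma grad_trunc_LIMSEQ: "(\<lambda>n. grad (\<lambda>x. trunc n (\<phi> x)) q) \<longlonglongrightarrow> grad \<phi> q"
  unfolding grad_def by (intro tendsto_diff trunc_LIMSEQ)

text \<open>\<open>z * \<phi>\<close> itself need not be integrable; truncating \<open>\<phi>\<close> reduces to the case where it is,
  and truncation does not increase \<open>\<bar>grad \<phi>\<bar>\<close>.\<close>

lemma integral_by_parts:
  assumes \<phi>: "sqint \<nu> \<phi>" and [measurable]: "z \<in> borel_measurable P"
    and anti: "\<And>q. z (prod.swap q) = - z q"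
    and loc: "\<And>\<psi>. bounded_finite_support \<nu> \<psi> \<Longrightarrow> integrable P (\<lambda>q. z q * \<psi> (fst q))"
    and int: "integrable P (\<lambda>q. z q * grad \<phi> q)"
    and intw: "integrable \<nu> (\<lambda>x. \<phi> x * (\<integral>y. z (x, y) \<partial>m x))"
  shows "(\<integral>q. z q * grad \<phi> q \<partial>P) = - 2 * (\<integral>x. \<phi> x * (\<integral>y. z (x, y) \<partial>m x) \<partial>\<nu>)"
proof -
  have [measurable]: "\<phi> \<in> borel_measurable \<nu>" using \<phi> by (rule sqint_measurable)
  have [measurable]: "(\<lambda>x. \<integral>y. z (x, y) \<partial>m x) \<in> borel_measurable \<nu>"
    by (rule integral_kernel_measurable) measurable
  let ?w = "\<lambda>x. \<integral>y. z (x, y) \<partial>m x"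
  have "(\<lambda>n. \<integral>q. z q * grad (\<lambda>x. trunc n (\<phi> x)) q \<partial>P) \<longlonglongrightarrow> (\<integral>q. z q * grad \<phi> q \<partial>P)"
    by (rule integral_dominated_convergence[where w="\<lambda>q. \<bar>z q * grad \<phi> q\<bar>"])
       (use integrable_abs[OF int] in \<open>auto intro!: AE_I2 tendsto_mult grad_trunc_LIMSEQ mult_left_mono abs_grad_trunc_le
          simp: abs_mult\<close>)
  moreover have "(\<integral>q. z q * grad (\<lambda>x. trunc n (\<phi> x)) q \<partial>P) = - 2 * (\<integral>x. trunc n (\<phi> x) * ?w x \<partial>\<nu>)" for n
    by (rule integral_by_parts_bounded)
       (auto intro!: anti loc trunc_bounded_finite_support \<phi>)
  moreover have "(\<lambda>n. - 2 * (\<integral>x. trunc n (\<phi> x) * ?w x \<partial>\<nu>)) \<longlonglongrightarrow> - 2 * (\<integral>x. \<phi> x * ?w x \<partial>\<nu>)"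
    by (intro tendsto_mult tendsto_const integral_dominated_convergence[where w="\<lambda>x. \<bar>\<phi> x * ?w x\<bar>"])
       (use integrable_abs[OF intw] in \<open>auto intro!: AE_I2 tendsto_mult trunc_LIMSEQ mult_right_mono abs_trunc_le
          simp: abs_mult\<close>)
  ultimately show ?thesis
    using LIMSEQ_unique by auto
qed

section \<open>The energies as integrals over the edges\<close>

text \<open>Lets one development with \<open>p \<ge> 1\<close> serve both energies.\<close>

lemma F1_eq_Fp: "F1 m \<nu> u = Fp 1 m \<nu> u"
  by (simp add: F1_def Fp_def)

lemma Fp_eq:
  assumes [measurable]: "u \<in> borel_measurable \<nu>"
  shows "Fp p m \<nu> u = enn2ereal (ennreal (1 / (2 * p)) * (\<integral>\<^sup>+q. ennreal (\<bar>grad u q\<bar> powr p) \<partial>P))"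
  unfolding Fp_def by (subst nn_integral_P) (auto simp: grad_def)

definition energy_finite :: "real \<Rightarrow> ('a \<Rightarrow> real) \<Rightarrow> bool" where
  "energy_finite p u \<longleftrightarrow> integrable P (\<lambda>q. \<bar>grad u q\<bar> powr p)"

text \<open>To be read together with \<open>energy_finite\<close>: the integral of a non-integrable
  function is 0 by default.\<close>

definition energy :: "real \<Rightarrow> ('a \<Rightarrow> real) \<Rightarrow> real" where
  "energy p u = (\<integral>q. \<bar>grad u q\<bar> powr p \<partial>P) / (2 * p)"

lemma energy_finite_iff_nn_integral:
  assumes [measurable]: "u \<in> borel_measurable \<nu>"
  shows "energy_finite p u \<longleftrightarrow> (\<integral>\<^sup>+ x. (\<integral>\<^sup>+ y. ennreal (\<bar>u y - u x\<bar> powr p) \<partial>(m x)) \<partial>\<nu>) < \<infinity>"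
  unfolding energy_finite_def integrable_iff_bounded by (subst nn_integral_P) (auto simp: grad_def)

lemma Fp_finite_iff:
  assumes [measurable]: "u \<in> borel_measurable \<nu>" and "p > 0"
  shows "Fp p m \<nu> u \<noteq> \<infinity> \<longleftrightarrow> energy_finite p u"
  using assms unfolding energy_finite_iff_nn_integral[OF assms(1)] Fp_def
  by (simp add: enn2ereal_eq_top_iff ennreal_mult_eq_top_iff top.not_eq_extremum)

lemma Fp_eq_energy:
  assumes [measurable]: "u \<in> borel_measurable \<nu>" and "p > 0" "energy_finite p u"
  shows "Fp p m \<nu> u = ereal (energy p u)"
proof -
  have "(\<integral>\<^sup>+q. ennreal (\<bar>grad u q\<bar> powr p) \<partial>P) = ennreal (\<integral>q. \<bar>grad u q\<bar> powr p \<partial>P)"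
    using assms by (intro nn_integral_eq_integral) (auto simp: energy_finite_def)
  then show ?thesis
    using assms by (simp add: Fp_eq energy_def ennreal_mult[symmetric] enn2ereal_ennreal)
qed

lemma energy_finite_add:
  assumes [measurable]: "u \<in> borel_measurable \<nu>" "w \<in> borel_measurable \<nu>"
    and "p \<ge> 0" "energy_finite p u" "energy_finite p w"
  shows "energy_finite p (\<lambda>x. u x + t * w x)"
  unfolding energy_finite_def
proof (rule Bochner_Integration.integrable_bound)
  show "integrable P (\<lambda>q. 2 powr p * (\<bar>grad u q\<bar> powr p + \<bar>t\<bar> powr p * \<bar>grad w q\<bar> powr p))"
    using assms by (simp add: energy_finite_def)
  show "AE q in P. norm (\<bar>grad (\<lambda>x. u x + t * w x) q\<bar> powr p)
      \<le> norm (2 powr p * (\<bar>grad u q\<bar> powr p + \<bar>t\<bar> powr p * \<bar>grad w q\<bar> powr p))"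
    using powr_abs_add_le[OF assms(3), of "grad u q" "t * grad w q" for q]
    by (auto simp: grad_add abs_mult powr_mult)
qed measurable

lemma integrable_grad_powr:
  assumes u: "bounded_finite_support \<nu> u" and "p \<ge> 0"
  shows "integrable P (\<lambda>q. \<bar>grad u q\<bar> powr p)"
proof (rule Bochner_Integration.integrable_bound)
  have [measurable]: "u \<in> borel_measurable \<nu>"
    using u by (rule bounded_finite_support_measurable)
  have int: "integrable \<nu> (\<lambda>x. \<bar>u x\<bar> powr p)"
    using u \<open>p \<ge> 0\<close> by (rule bounded_finite_support_integrable_powr)
  show "integrable P (\<lambda>q. 2 powr p * (\<bar>u (snd q)\<bar> powr p + \<bar>u (fst q)\<bar> powr p))"
    using integrable_fst[OF int] integrable_snd[OF int] by simp
  show "AE q in P. norm (\<bar>grad u q\<bar> powr p) \<le> norm (2 powr p * (\<bar>u (snd q)\<bar> powr p + \<bar>u (fst q)\<bar> powr p))"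
    using powr_abs_add_le[OF \<open>p \<ge> 0\<close>, of "u (snd q)" "- u (fst q)" for q] by (auto simp: grad_def)
  show "(\<lambda>q. \<bar>grad u q\<bar> powr p) \<in> borel_measurable P" by measurable
qed

lemma bounded_finite_support_energy_finite:
  "bounded_finite_support \<nu> u \<Longrightarrow> p \<ge> 0 \<Longrightarrow> energy_finite p u"
  unfolding energy_finite_def by (rule integrable_grad_powr)

text \<open>For \<open>p = 1\<close> the flux is \<open>sgn\<close>, so this is also the selection of \<open>\<Delta>\<^sub>1\<close> that vanishes
  where the gradient does.\<close>

definition lap :: "real \<Rightarrow> ('a \<Rightarrow> real) \<Rightarrow> 'a \<Rightarrow> real" where
  "lap p u x = (\<integral>y. pflux p (grad u (x, y)) \<partial>m x)"

lemma lap_eq: "lap p u x = (\<integral>y. \<bar>u y - u x\<bar> powr (p - 2) * (u y - u x) \<partial>(m x))"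
  by (simp add: lap_def pflux_def grad_def)

lemma lap_measurable [measurable]:
  assumes [measurable]: "u \<in> borel_measurable \<nu>"
  shows "lap p u \<in> borel_measurable \<nu>"
  unfolding lap_def[abs_def] by (rule integral_kernel_measurable) measurable

lemma integrable_pflux_mult:
  assumes [measurable]: "u \<in> borel_measurable \<nu>" "g \<in> borel_measurable P"
    and "p \<ge> 1" "energy_finite p u" "integrable P (\<lambda>q. \<bar>g q\<bar> powr p)"
  shows "integrable P (\<lambda>q. pflux p (grad u q) * g q)"
proof (rule Bochner_Integration.integrable_bound)
  show "integrable P (\<lambda>q. \<bar>grad u q\<bar> powr p + \<bar>g q\<bar> powr p)"
    using assms by (simp add: energy_finite_def)
  show "AE q in P. norm (pflux p (grad u q) * g q) \<le> norm (\<bar>grad u q\<bar> powr p + \<bar>g q\<bar> powr p)"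
    using powr_mult_abs_le[OF \<open>p \<ge> 1\<close>] by (auto simp: abs_mult abs_pflux)
qed measurable

lemma integrable_pflux_mult_fst:
  assumes [measurable]: "u \<in> borel_measurable \<nu>" and "p \<ge> 1" "energy_finite p u"
    and \<psi>: "bounded_finite_support \<nu> \<psi>"
  shows "integrable P (\<lambda>q. pflux p (grad u q) * \<psi> (fst q))"
proof -
  have [measurable]: "\<psi> \<in> borel_measurable \<nu>"
    using \<psi> by (rule bounded_finite_support_measurable)
  show ?thesis
    using assms integrable_fst[OF bounded_finite_support_integrable_powr[OF \<psi>, of p]]
    by (intro integrable_pflux_mult) auto
qed

lemma lap_by_parts_bounded:
  assumes [measurable]: "u \<in> borel_measurable \<nu>" and "p \<ge> 1" "energy_finite p u"
    and \<psi>: "bounded_finite_support \<nu> \<psi>"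
  shows "integrable P (\<lambda>q. pflux p (grad u q) * grad \<psi> q)"
    and "integrable \<nu> (\<lambda>x. \<psi> x * lap p u x)"
    and "(\<integral>q. pflux p (grad u q) * grad \<psi> q \<partial>P) = - 2 * (\<integral>x. \<psi> x * lap p u x \<partial>\<nu>)"
proof -
  have [measurable]: "\<psi> \<in> borel_measurable \<nu>"
    using \<psi> by (rule bounded_finite_support_measurable)
  note * = integral_by_parts_bounded[of \<psi> "\<lambda>q. pflux p (grad u q)",
      OF _ _ _ integrable_pflux_mult_fst[OF assms]]
  show "integrable P (\<lambda>q. pflux p (grad u q) * grad \<psi> q)"
    by (rule *) (auto simp: grad_swap pflux_minus)
  show "integrable \<nu> (\<lambda>x. \<psi> x * lap p u x)"
    unfolding lap_def by (rule *) (auto simp: grad_swap pflux_minus)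
  show "(\<integral>q. pflux p (grad u q) * grad \<psi> q \<partial>P) = - 2 * (\<integral>x. \<psi> x * lap p u x \<partial>\<nu>)"
    unfolding lap_def by (rule *) (auto simp: grad_swap pflux_minus)
qed

section \<open>Subgradients and contraction property of a single energy\<close>

text \<open>Integrating the tangent inequality over the edges gives a term linear in
  \<open>f - u\<close>. Integration by parts turns it into a pairing with \<open>lap p u\<close>,
  and the factor \<open>2 * p\<close> it carries cancels the normalisation of the energy.\<close>

lemma energy_subgradient:
  assumes u: "sqint \<nu> u" and "p \<ge> 1" "energy_finite p u" and lap: "sqint \<nu> (lap p u)"
    and f: "sqint \<nu> f" and "energy_finite p f"
  shows "energy p u - (\<integral>x. lap p u x * (f x - u x) \<partial>\<nu>) \<le> energy p f"
proof -
  have [measurable]: "u \<in> borel_measurable \<nu>" "f \<in> borel_measurable \<nu>"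
    using u f by (auto intro: sqint_measurable)
  define \<phi> where "\<phi> = (\<lambda>x. f x - u x)"
  have \<phi>: "sqint \<nu> \<phi>" unfolding \<phi>_def using f u by (rule sqint_diff)
  then have [measurable]: "\<phi> \<in> borel_measurable \<nu>" by (rule sqint_measurable)
  have "energy_finite p \<phi>"
    using energy_finite_add[of f u p "-1"] assms by (simp add: \<phi>_def)
  then have int: "integrable P (\<lambda>q. pflux p (grad u q) * grad \<phi> q)"
    using assms by (intro integrable_pflux_mult) (auto simp: energy_finite_def)
  have "(\<integral>q. pflux p (grad u q) * grad \<phi> q \<partial>P) = - 2 * (\<integral>x. \<phi> x * lap p u x \<partial>\<nu>)"
    unfolding lap_def
    by (rule integral_by_parts)
       (use assms int \<phi> sqint_mult_integrable[OF \<phi> lap] in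
         \<open>auto simp: grad_swap pflux_minus lap_def intro!: integrable_pflux_mult_fst\<close>)
  moreover have "(\<integral>q. \<bar>grad u q\<bar> powr p + p * (pflux p (grad u q) * grad \<phi> q) \<partial>P)
      \<le> (\<integral>q. \<bar>grad f q\<bar> powr p \<partial>P)"
    using assms int powr_abs_gradient_ineq[OF \<open>p \<ge> 1\<close>]
    by (intro integral_mono) (auto simp: energy_finite_def \<phi>_def grad_diff)
  ultimately have "(\<integral>q. \<bar>grad u q\<bar> powr p \<partial>P) - 2 * p * (\<integral>x. \<phi> x * lap p u x \<partial>\<nu>) \<le> (\<integral>q. \<bar>grad f q\<bar> powr p \<partial>P)"
    using int assms by (simp add: energy_finite_def)
  then have "((\<integral>q. \<bar>grad u q\<bar> powr p \<partial>P) - 2 * p * (\<integral>x. \<phi> x * lap p u x \<partial>\<nu>)) / (2 * p)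
      \<le> (\<integral>q. \<bar>grad f q\<bar> powr p \<partial>P) / (2 * p)"
    using \<open>p \<ge> 1\<close> by (intro divide_right_mono) auto
  then show ?thesis
    using \<open>p \<ge> 1\<close> by (simp add: energy_def \<phi>_def diff_divide_distrib mult.commute)
qed

lemma Fp_subdiff_lap:
  assumes u: "sqint \<nu> u" and "p \<ge> 1" "energy_finite p u" and lap: "sqint \<nu> (lap p u)"
  shows "subdiff \<nu> (Fp p m \<nu>) u (\<lambda>x. - lap p u x)"
  unfolding subdiff_def
proof (intro conjI allI impI)
  show "Fp p m \<nu> u \<noteq> \<infinity>"
    using assms by (subst Fp_finite_iff) (auto intro: sqint_measurable)
  fix f assume f: "sqint \<nu> f"
  show "Fp p m \<nu> u + ereal (\<integral>x. - lap p u x * (f x - u x) \<partial>\<nu>) \<le> Fp p m \<nu> f"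
  proof (cases "Fp p m \<nu> f = \<infinity>")
    case False
    then have "energy_finite p f"
      using assms f by (subst (asm) Fp_finite_iff) (auto intro: sqint_measurable)
    then show ?thesis
      using assms f energy_subgradient[OF assms f] by (simp add: Fp_eq_energy sqint_measurable)
  qed simp
qed (use assms in \<open>auto intro: sqint_minus\<close>)

text \<open>The flux of a test function is bounded and integrable. Both properties pass to its
  average \<open>lap p u\<close>, and a bounded integrable function is square-integrable.\<close>

lemma sqint_lap_bounded_finite_support:
  assumes u: "bounded_finite_support \<nu> u" and "p \<ge> 1"
  shows "sqint \<nu> (lap p u)"
proof -
  have [measurable]: "u \<in> borel_measurable \<nu>"
    using u by (rule bounded_finite_support_measurable)
  have int: "integrable P (\<lambda>q. pflux p (grad u q))"
    using integrable_grad_powr[OF u, of "p - 1"] \<open>p \<ge> 1\<close>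
    by (subst integrable_abs_iff[symmetric]) (auto simp: abs_pflux)
  obtain M where M: "\<And>x. x \<in> space \<nu> \<Longrightarrow> \<bar>u x\<bar> \<le> M"
    using u by (auto simp: bounded_finite_support_def)
  \<comment> \<open>The gradient is at most \<open>2 * M\<close> in modulus, and the flux has order
    \<open>p - 1\<close>.\<close>
  define K where "K = (2 * M) powr (p - 1)"
  have K: "\<bar>pflux p (grad u (x, y))\<bar> \<le> K" if "x \<in> space \<nu>" "y \<in> space \<nu>" for x y
    using M[OF that(1)] M[OF that(2)] \<open>p \<ge> 1\<close>
    by (auto simp: abs_pflux K_def grad_def intro!: powr_mono2)
  have "AE x in \<nu>. \<bar>lap p u x\<bar> \<le> K"
    using integrable_disintegrate(1)[OF int] AE_space
  proof eventually_elim
    case (elim x)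
    interpret prob_space "m x" using elim by (intro prob_space_kernel)
    have "\<bar>lap p u x\<bar> \<le> (\<integral>y. \<bar>pflux p (grad u (x, y))\<bar> \<partial>m x)"
      unfolding lap_def by (rule integral_abs_bound)
    also have "\<dots> \<le> K"
      using elim K[of x] by (intro integral_le_const) (auto simp: space_kernel intro!: AE_I2)
    finally show ?case .
  qed
  moreover have "integrable \<nu> (\<lambda>x. K * \<bar>lap p u x\<bar>)"
    using integrable_disintegrate(2)[OF int] by (auto simp: lap_def[abs_def])
  moreover have "r\<^sup>2 \<le> K * \<bar>r\<bar>" if "\<bar>r\<bar> \<le> K" for r
    using mult_right_mono[OF that, of "\<bar>r\<bar>"] by (simp add: power2_eq_square)
  ultimately show ?thesis
    by (intro sqint_bound[where g="\<lambda>x. K * \<bar>lap p u x\<bar>"]) (auto elim!: eventually_mono)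
qed

text \<open>On each edge the gradient of \<open>h (u1 - u2)\<close> lies between 0 and the gradient
  of \<open>u1 - u2\<close>, by monotonicity and the Lipschitz bound. Hence
  \<open>powr_abs_contract\<close> applies edge by edge.\<close>

lemma Fp_contract:
  assumes [measurable]: "u1 \<in> borel_measurable \<nu>" "u2 \<in> borel_measurable \<nu>"
    and [measurable]: "h \<in> borel_measurable borel" and "p \<ge> 1"
    and mono: "\<And>s t. s \<le> t \<Longrightarrow> 0 \<le> h t - h s \<and> h t - h s \<le> t - s"
  shows "Fp p m \<nu> (\<lambda>x. u1 x - h (u1 x - u2 x)) + Fp p m \<nu> (\<lambda>x. u2 x + h (u1 x - u2 x))
     \<le> Fp p m \<nu> u1 + Fp p m \<nu> u2"
proof -
  let ?h = "\<lambda>x. h (u1 x - u2 x)"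
  have pt: "\<bar>grad (\<lambda>x. u1 x - ?h x) q\<bar> powr p + \<bar>grad (\<lambda>x. u2 x + ?h x) q\<bar> powr p
      \<le> \<bar>grad u1 q\<bar> powr p + \<bar>grad u2 q\<bar> powr p" for q
  proof -
    define d where "d = grad ?h q"
    have "0 \<le> d \<and> d \<le> grad u1 q - grad u2 q \<or> grad u1 q - grad u2 q \<le> d \<and> d \<le> 0"
      using mono[of "u1 (fst q) - u2 (fst q)" "u1 (snd q) - u2 (snd q)"]
        mono[of "u1 (snd q) - u2 (snd q)" "u1 (fst q) - u2 (fst q)"]
      unfolding d_def grad_def
      by (cases "u1 (fst q) - u2 (fst q) \<le> u1 (snd q) - u2 (snd q)") linarith+
    from powr_abs_contract[OF \<open>p \<ge> 1\<close> this]
    show ?thesis by (simp add: d_def grad_def algebra_simps)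
  qed
  have "(\<integral>\<^sup>+q. ennreal (\<bar>grad (\<lambda>x. u1 x - ?h x) q\<bar> powr p) \<partial>P) +
      (\<integral>\<^sup>+q. ennreal (\<bar>grad (\<lambda>x. u2 x + ?h x) q\<bar> powr p) \<partial>P) \<le>
      (\<integral>\<^sup>+q. ennreal (\<bar>grad u1 q\<bar> powr p) \<partial>P) + (\<integral>\<^sup>+q. ennreal (\<bar>grad u2 q\<bar> powr p) \<partial>P)"
    using pt
    by (subst (1 2) nn_integral_add[symmetric])
       (auto intro!: nn_integral_mono simp: ennreal_plus[symmetric] simp del: ennreal_plus)
  then show ?thesis
    by (simp add: Fp_eq distrib_left[symmetric] plus_ennreal.rep_eq[symmetric] less_eq_ennreal.rep_eq[symmetric]
        mult_left_mono)
qed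

end

section \<open>Complete accretivity of subdifferentials\<close>

text \<open>Passes from the limit inferior over punctured neighbourhoods to full neighbourhoods,
  which is the form in which lower semicontinuity is used.\<close>

lemma admissible_j_eventually_greater:
  assumes "admissible_j j" "a < j x"
  shows "\<forall>\<^sub>F y in nhds x. a < j y"
proof -
  have "a < Liminf (at x) j"
    using assms by (auto simp: admissible_j_def intro: less_le_trans)
  then have "\<forall>\<^sub>F y in at x. a < j y" by (rule less_LiminfD)
  with assms(2) show ?thesis
    by (simp add: eventually_at_filter) (auto elim: eventually_mono)
qed

lemma admissible_j_measurable:
  assumes "admissible_j j" shows "j \<in> borel_measurable borel"
proof (rule borel_measurableI_greater)
  fix a
  have "open {x. a < j x}"
    unfolding open_subopen[of "{x. a < j x}"]
    using admissible_j_eventually_greater[OF assms] by (simp add: eventually_nhds subset_eq)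
  then show "{x \<in> space borel. a < j x} \<in> sets borel" by simp
qed

text \<open>\<open>prox_at j k s r\<close> expresses \<open>k (s - r) \<in> \<partial>j(r)\<close>, i.e. \<open>r\<close> minimises
  \<open>t \<mapsto> j(t) + k (s - t)\<^sup>2 / 2\<close>.\<close>

definition prox_at :: "(real \<Rightarrow> ennreal) \<Rightarrow> real \<Rightarrow> real \<Rightarrow> real \<Rightarrow> bool" where
  "prox_at j k s r \<longleftrightarrow> j r < \<infinity> \<and>
     (\<forall>t. j t < \<infinity> \<longrightarrow> enn2real (j r) + k * (s - r) * (t - r) \<le> enn2real (j t))"

text \<open>The direct method: the quadratic term keeps a minimising sequence of \<open>G\<close>
  bounded, a subsequence converges, and lower semicontinuity makes its limit a minimiser. Comparing
  with points on the segment to \<open>y\<close> then gives the variational inequality.\<close>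

lemma prox_at_exists:
  assumes j: "admissible_j j" and k: "k > 0"
  shows "\<exists>r. prox_at j k s r"
proof -
  define G where "G t = enn2real (j t) + k / 2 * (s - t)\<^sup>2" for t
  define D where "D = {t. j t < \<infinity>}"
  have D0: "0 \<in> D" using j by (simp add: D_def admissible_j_def)
  have Gnn: "0 \<le> G t" for t using k by (simp add: G_def)
  define i where "i = (INF t\<in>D. G t)"
  have bdd: "bdd_below (G ` D)" using Gnn by (auto intro!: bdd_belowI)
  have i_le: "i \<le> G t" if "t \<in> D" for t
    unfolding i_def by (rule cINF_lower[OF bdd that])
  have "\<exists>t\<in>D. G t < i + 1 / real (Suc n)" for n
    using cINF_less_iff[OF _ bdd, of "i + 1 / real (Suc n)"] D0 by (auto simp: i_def)
  then obtain t where tD: "\<And>n. t n \<in> D" and tG: "\<And>n. G (t n) < i + 1 / real (Suc n)" by metis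
  have "\<bar>s - t n\<bar> \<le> (i + 1) * 2 / k + 1" for n
  proof -
    have "i + 1 / real (Suc n) \<le> i + 1" by simp
    then have "k / 2 * (s - t n)\<^sup>2 \<le> i + 1" using tG[of n] enn2real_nonneg[of "j (t n)"] unfolding G_def by linarith
    then have "(s - t n)\<^sup>2 \<le> (i + 1) * 2 / k" using k by (simp add: field_simps)
    \<comment> \<open>Bounds the distance by its square and so avoids a square root.\<close>
    moreover have "\<bar>s - t n\<bar> \<le> (s - t n)\<^sup>2 + 1"
    proof -
      have "d \<le> d\<^sup>2 + 1" if "0 \<le> d" for d :: real
      proof (cases "d \<le> 1")
        case False
        then have "d * 1 \<le> d * d" by (intro mult_left_mono) auto
        then show ?thesis by (simp add: power2_eq_square)
      qed (auto intro: add_increasing)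
      from this[of "\<bar>s - t n\<bar>"] show ?thesis by simp
    qed
    ultimately show ?thesis by simp
  qed
  then have "t n \<in> cball s ((i + 1) * 2 / k + 1)" for n by (simp add: dist_real_def)
  then obtain r \<sigma> where \<sigma>: "strict_mono \<sigma>" and lim: "(t \<circ> \<sigma>) \<longlonglongrightarrow> r"
    using compact_cball[of s "(i + 1) * 2 / k + 1"] unfolding compact_def by meson
  have Glim: "(\<lambda>n. G (t (\<sigma> n))) \<longlonglongrightarrow> i"
  proof (rule LIMSEQ_subseq_LIMSEQ[OF _ \<sigma>, unfolded o_def, of "\<lambda>n. G (t n)"])
    have lim_i: "(\<lambda>n. i + 1 / real (Suc n)) \<longlonglongrightarrow> i"
      using tendsto_add[OF tendsto_const LIMSEQ_Suc[OF lim_1_over_n], of i] by simp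
    show "(\<lambda>n. G (t n)) \<longlonglongrightarrow> i"
      by (rule tendsto_sandwich[OF _ _ tendsto_const lim_i])
         (intro always_eventually allI i_le[OF tD] less_imp_le[OF tG])+
  qed
  \<comment> \<open>The limit of \<open>j\<close> along the subsequence, obtained by subtracting the
    quadratic term from \<open>G\<close>.\<close>
  define b where "b = i - k / 2 * (s - r)\<^sup>2"
  have "(\<lambda>n. G (t (\<sigma> n)) - k / 2 * (s - t (\<sigma> n))\<^sup>2) \<longlonglongrightarrow> b"
    unfolding b_def using lim by (intro tendsto_intros Glim) (simp add: o_def)
  then have "(\<lambda>n. enn2real (j (t (\<sigma> n)))) \<longlonglongrightarrow> b" by (simp add: G_def)
  then have "(\<lambda>n. ennreal (enn2real (j (t (\<sigma> n))))) \<longlonglongrightarrow> ennreal b" and b0: "b \<ge> 0"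
    by (auto intro: tendsto_ennrealI LIMSEQ_le_const)
  moreover have "ennreal (enn2real (j (t (\<sigma> n)))) = j (t (\<sigma> n))" for n
    using tD by (simp add: D_def)
  ultimately have jlim: "(\<lambda>n. j (t (\<sigma> n))) \<longlonglongrightarrow> ennreal b"
    by (simp only:)
  have "j r \<le> ennreal b"
  proof (rule dense_le)
    fix a assume "a < j r"
    from admissible_j_eventually_greater[OF j this] lim
    have "\<forall>\<^sub>F n in sequentially. a < j (t (\<sigma> n))"
      by (auto simp: filterlim_iff o_def)
    then show "a \<le> ennreal b"
      by (intro tendsto_lowerbound[OF jlim]) (auto elim: eventually_mono)
  qed
  then have rD: "r \<in> D" and "enn2real (j r) \<le> b"
    using b0 by (auto simp: D_def le_less_trans enn2real_leI)
  then have Gr: "G r \<le> i" by (simp add: G_def b_def)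
  have "enn2real (j r) + k * (s - r) * (y - r) \<le> enn2real (j y)" if y: "j y < \<infinity>" for y
  proof -
    define A B where "A = enn2real (j r)" and "B = enn2real (j y)"
    have jA: "j r = ennreal A" and jB: "j y = ennreal B"
      using rD y by (auto simp: A_def B_def D_def)
    have AB: "A \<ge> 0" "B \<ge> 0" by (auto simp: A_def B_def)
    \<comment> \<open>Minimality of \<open>r\<close> is used at the point a fraction
      \<open>l\<close> of the way to \<open>y\<close>. After division by \<open>l\<close> the
      quadratic remainder still carries a factor \<open>l\<close> and vanishes in the limit.\<close>
    have step: "A + k * (s - r) * (y - r) \<le> B + l * (k / 2 * (y - r)\<^sup>2)" if l: "0 < l" "l \<le> 1" for l
    proof -
      define z where "z = l * y + (1 - l) * r"
      have "j z \<le> ennreal l * j y + ennreal (1 - l) * j r"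
        using j l unfolding admissible_j_def z_def by auto
      also have "\<dots> = ennreal (l * B + (1 - l) * A)"
        using AB l by (simp add: jA jB ennreal_mult ennreal_plus)
      finally have jz: "j z \<le> ennreal (l * B + (1 - l) * A)" .
      have "j z < \<infinity>" using le_less_trans[OF jz] by simp
      then have "z \<in> D" by (simp add: D_def)
      have "enn2real (j z) \<le> l * B + (1 - l) * A"
        using jz AB l by (intro enn2real_leI) auto
      with i_le[OF \<open>z \<in> D\<close>] Gr have "A + k / 2 * (s - r)\<^sup>2 \<le> l * B + (1 - l) * A + k / 2 * (s - z)\<^sup>2"
        by (simp add: G_def A_def)
      moreover have "(s - z)\<^sup>2 = (s - r)\<^sup>2 - 2 * l * ((s - r) * (y - r)) + l\<^sup>2 * (y - r)\<^sup>2"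
        unfolding z_def by (simp add: power2_eq_square algebra_simps)
      moreover have "k / 2 * ((s - r)\<^sup>2 - 2 * l * ((s - r) * (y - r)) + l\<^sup>2 * (y - r)\<^sup>2)
          = k / 2 * (s - r)\<^sup>2 - l * (k * (s - r) * (y - r)) + l * (l * (k / 2 * (y - r)\<^sup>2))"
        by (simp add: power2_eq_square algebra_simps)
      ultimately have "l * A + l * (k * (s - r) * (y - r)) \<le> l * B + l * (l * (k / 2 * (y - r)\<^sup>2))"
        by (simp add: left_diff_distrib)
      then have "l * (A + k * (s - r) * (y - r)) \<le> l * (B + l * (k / 2 * (y - r)\<^sup>2))"
        by (simp only: distrib_left)
      then show ?thesis using l by (simp only: mult_le_cancel_left_pos)
    qed
    have "((\<lambda>l. B + l * (k / 2 * (y - r)\<^sup>2)) \<longlongrightarrow> B + 0 * (k / 2 * (y - r)\<^sup>2)) (at_right 0)"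
      by (intro tendsto_intros)
    moreover have "\<forall>\<^sub>F l in at_right 0. A + k * (s - r) * (y - r) \<le> B + l * (k / 2 * (y - r)\<^sup>2)"
      using eventually_at_right_real[OF zero_less_one] by eventually_elim (rule step; simp)
    ultimately have "A + k * (s - r) * (y - r) \<le> B + 0 * (k / 2 * (y - r)\<^sup>2)"
      by (rule tendsto_lowerbound) simp
    then show ?thesis by (simp add: A_def B_def)
  qed
  with rD show ?thesis by (auto simp: prox_at_def D_def)
qed

text \<open>Firm nonexpansiveness: testing each variational inequality at the other proximal point
  and adding gives \<open>(d - e) * d \<le> 0\<close> with \<open>d = r' - r\<close> and
  \<open>e = s' - s\<close>, which for \<open>e \<ge> 0\<close> puts \<open>d\<close> between 0 and
  \<open>e\<close>.\<close>

lemma prox_at_contract: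
  assumes "prox_at j k s r" "prox_at j k s' r'" "k > 0" "s \<le> s'"
  shows "0 \<le> r' - r \<and> r' - r \<le> s' - s"
proof -
  have "k * (s - r) * (r' - r) + k * (s' - r') * (r - r') \<le> 0"
    using assms(1,2) unfolding prox_at_def by (smt (verit))
  then have "k * ((r' - r - (s' - s)) * (r' - r)) \<le> 0" by (simp add: algebra_simps)
  then have le: "(r' - r - (s' - s)) * (r' - r) \<le> 0" using \<open>k > 0\<close> by (simp add: mult_le_0_iff)
  with assms(4) show ?thesis by (auto simp: mult_le_0_iff)
qed

lemma prox_at_0:
  assumes "prox_at j k 0 r" "k > 0" "admissible_j j" shows "r = 0"
proof -
  have *: "enn2real (j r) + k * (0 - r) * (0 - r) \<le> enn2real (j 0)"
    using assms(1,3) unfolding prox_at_def admissible_j_def by (metis ennreal_zero_less_top infinity_ennreal_def)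
  have "k * r\<^sup>2 \<le> 0"
  proof -
    have "j 0 = 0" using assms(3) by (simp add: admissible_j_def)
    with * have "enn2real (j r) + k * r\<^sup>2 \<le> 0" by (simp add: power2_eq_square mult.assoc)
    then show ?thesis using enn2real_nonneg[of "j r"] by linarith
  qed
  then show ?thesis using \<open>k > 0\<close> by (simp add: mult_le_0_iff)
qed

text \<open>The nonexpansive monotone test functions \<open>s - r\<close> with \<open>prox_at j k s r\<close> are multiples of the derivative of
  the Moreau--Yosida regularisation of \<open>j\<close>; the general \<open>j\<close> is reached by letting \<open>k\<close> grow.\<close>

lemma nn_integral_j_le:
  assumes f: "sqint \<nu> f" and g: "sqint \<nu> g" and lam: "lam > 0" and j: "admissible_j j"
    and test: "\<And>h. (\<And>s t. s \<le> t \<Longrightarrow> 0 \<le> h t - h s \<and> h t - h s \<le> t - s) \<Longrightarrow> h 0 = 0 \<Longrightarrow>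
        0 \<le> (\<integral>x. g x * h (f x) \<partial>\<nu>)"
  shows "(\<integral>\<^sup>+x. j (f x) \<partial>\<nu>) \<le> (\<integral>\<^sup>+x. j (f x + lam * g x) \<partial>\<nu>)"
proof -
  have [measurable]: "f \<in> borel_measurable \<nu>" "g \<in> borel_measurable \<nu>"
    using f g by (auto intro: sqint_measurable)
  note [measurable] = admissible_j_measurable[OF j]
  obtain J where J: "\<And>n s. prox_at j (real (Suc n)) s (J n s)"
    using prox_at_exists[OF j, of "real (Suc n)" for n] by (metis of_nat_0_less_iff zero_less_Suc)
  \<comment> \<open>As \<open>J n\<close> is nondecreasing and nonexpansive, so is its complement
    \<open>h n\<close>, and \<open>test\<close> applies to it.\<close>
  define h where "h n s = s - J n s" for n s
  have Jmono: "0 \<le> J n t - J n s \<and> J n t - J n s \<le> t - s" if "s \<le> t" for n s t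
    using prox_at_contract[OF J J _ that] by simp
  have hmono: "0 \<le> h n t - h n s \<and> h n t - h n s \<le> t - s" if "s \<le> t" for n s t
    using Jmono[OF that, of n] by (auto simp: h_def)
  have h0: "h n 0 = 0" for n
    using prox_at_0[OF J _ j] by (simp add: h_def)
  have [measurable]: "J n \<in> borel_measurable borel" for n
    using Jmono by (intro borel_measurable_mono monoI) (metis diff_ge_0_iff_ge)
  have [measurable]: "h n \<in> borel_measurable borel" for n
    unfolding h_def by measurable
  have habs: "\<bar>h n s\<bar> \<le> \<bar>s\<bar>" for n s
    using hmono[of 0 s n] hmono[of s 0 n] h0[of n] by (cases "s \<ge> 0") auto
  \<comment> \<open>The proximal inequality at the point \<open>f x + lam * g x\<close> bounds
    \<open>j\<close> there from below by \<open>E n (f x)\<close> plus a positive multiple of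
    \<open>g x * h n (f x)\<close>, whose integral is nonnegative by \<open>test\<close>.\<close>
  define E where "E n s = j (J n s) + ennreal (real (Suc n) * (h n s)\<^sup>2)" for n s
  have [measurable]: "E n \<in> borel_measurable borel" for n
    unfolding E_def by measurable
  have bound: "(\<integral>\<^sup>+x. E n (f x) \<partial>\<nu>) \<le> (\<integral>\<^sup>+x. j (f x + lam * g x) \<partial>\<nu>)" for n
  proof -
    define k where "k = real (Suc n)"
    have k: "k > 0" by (simp add: k_def)
    define X where "X x = k * lam * (g x * h n (f x))" for x
    have "sqint \<nu> (\<lambda>x. h n (f x))"
      using f habs by (intro sqint_bound[where g="\<lambda>x. (f x)\<^sup>2"]) (auto simp: sqint_def abs_le_square_iff)
    then have "integrable \<nu> (\<lambda>x. g x * h n (f x))"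
      using g by (intro sqint_mult_integrable)
    then have Xint: "integrable \<nu> X" unfolding X_def by simp
    have Xm [measurable]: "X \<in> borel_measurable \<nu>" using Xint by auto
    have "0 \<le> (\<integral>x. g x * h n (f x) \<partial>\<nu>)" using test[of "h n"] hmono h0 by blast
    then have X0: "0 \<le> (\<integral>x. X x \<partial>\<nu>)" using k lam by (simp add: X_def)
    have fin: "(\<integral>\<^sup>+x. ennreal (X x) \<partial>\<nu>) < \<infinity>" "(\<integral>\<^sup>+x. ennreal (- X x) \<partial>\<nu>) < \<infinity>"
      using Xint by (auto simp: real_integrable_def top.not_eq_extremum)
    have "enn2real (\<integral>\<^sup>+x. ennreal (- X x) \<partial>\<nu>) \<le> enn2real (\<integral>\<^sup>+x. ennreal (X x) \<partial>\<nu>)"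
      using X0 Xint by (simp add: real_lebesgue_integral_def)
    then have le: "(\<integral>\<^sup>+x. ennreal (- X x) \<partial>\<nu>) \<le> (\<integral>\<^sup>+x. ennreal (X x) \<partial>\<nu>)"
      using fin by (metis ennreal_enn2real_if ennreal_leI less_irrefl infinity_ennreal_def)
    \<comment> \<open>\<open>X\<close> may change sign and \<open>j\<close> may be infinite, so the
      positive and negative parts of \<open>X\<close> are kept on opposite sides, inside
      \<open>ennreal\<close>.\<close>
    have pt: "E n (f x) + ennreal (X x) \<le> j (f x + lam * g x) + ennreal (- X x)" for x
    proof (cases "j (f x + lam * g x) < \<infinity>")
      case True
      define A B where "A = enn2real (j (J n (f x)))" and "B = enn2real (j (f x + lam * g x))"
      have jJ: "j (J n (f x)) < \<infinity>" using J by (simp add: prox_at_def)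
      have jA: "j (J n (f x)) = ennreal A" and jB: "j (f x + lam * g x) = ennreal B"
        using jJ True by (auto simp: A_def B_def)
      have AB: "A \<ge> 0" "B \<ge> 0" by (auto simp: A_def B_def)
      have "A + k * (f x - J n (f x)) * (f x + lam * g x - J n (f x)) \<le> B"
        using J[of n "f x"] True unfolding prox_at_def A_def B_def k_def by blast
      then have ineq: "A + k * (h n (f x))\<^sup>2 + X x \<le> B"
        by (simp add: h_def X_def power2_eq_square algebra_simps)
      have kh: "k * (h n (f x))\<^sup>2 \<ge> 0" using k by simp
      have "E n (f x) + ennreal (X x) = ennreal (A + k * (h n (f x))\<^sup>2 + max 0 (X x))"
        unfolding E_def jA k_def[symmetric] using AB kh
        by (subst ennreal_max_0[symmetric]) (simp add: ennreal_plus del: ennreal_max_0)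
      also have "\<dots> \<le> ennreal (B + max 0 (- X x))" using ineq by (intro ennreal_leI) auto
      also have "\<dots> = j (f x + lam * g x) + ennreal (- X x)"
        unfolding jB using AB by (subst (2) ennreal_max_0[symmetric]) (simp add: ennreal_plus del: ennreal_max_0)
      finally show ?thesis .
    qed (auto simp: not_less top_unique)
    have "(\<integral>\<^sup>+x. E n (f x) \<partial>\<nu>) + (\<integral>\<^sup>+x. ennreal (X x) \<partial>\<nu>) \<le>
        (\<integral>\<^sup>+x. j (f x + lam * g x) \<partial>\<nu>) + (\<integral>\<^sup>+x. ennreal (- X x) \<partial>\<nu>)"
      using pt by (subst (1 2) nn_integral_add[symmetric]) (auto intro!: nn_integral_mono)
    also have "\<dots> \<le> (\<integral>\<^sup>+x. j (f x + lam * g x) \<partial>\<nu>) + (\<integral>\<^sup>+x. ennreal (X x) \<partial>\<nu>)"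
      using le by (intro add_left_mono)
    finally show ?thesis
      using fin(1) by (metis add.commute ennreal_add_left_cancel_le infinity_ennreal_def less_irrefl)
  qed
  \<comment> \<open>Either \<open>J n s\<close> is close to \<open>s\<close>, where \<open>j\<close>
    exceeds \<open>a\<close> by lower semicontinuity, or the penalty is large. Fatou's lemma then
    removes the regularisation.\<close>
  have lim: "j s \<le> liminf (\<lambda>n. E n s)" for s
    unfolding le_Liminf_iff
  proof (intro allI impI)
    fix a assume a: "a < j s"
    then obtain d where d: "d > 0" and near: "\<And>t. dist t s < d \<Longrightarrow> a < j t"
      using admissible_j_eventually_greater[OF j a] unfolding eventually_nhds_metric by blast
    have "a < top" using a top_greatest by (rule less_le_trans)
    then obtain b where b: "a = ennreal b" "b \<ge> 0" by (auto simp: less_top_ennreal)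
    \<comment> \<open>From this index on, a displacement of at least \<open>d\<close> costs a
      penalty above \<open>b\<close>.\<close>
    have "\<forall>\<^sub>F n in sequentially. b / d\<^sup>2 \<le> real n"
      using filterlim_real_sequentially by (simp add: filterlim_at_top)
    then show "\<forall>\<^sub>F n in sequentially. a < E n s"
    proof eventually_elim
      case (elim n)
      show ?case
      proof (cases "dist (J n s) s < d")
        case True
        then show ?thesis using near[of "J n s"] by (simp add: E_def add_increasing2 less_le_trans)
      next
        case False
        then have "d\<^sup>2 \<le> (h n s)\<^sup>2"
          using d by (simp add: h_def dist_real_def abs_le_square_iff[symmetric] abs_minus_commute)
        have "b \<le> real n * d\<^sup>2" using elim d by (simp add: field_simps)
        also have "\<dots> < real (Suc n) * d\<^sup>2" using d by simp
        also have "\<dots> \<le> real (Suc n) * (h n s)\<^sup>2" using \<open>d\<^sup>2 \<le> (h n s)\<^sup>2\<close> by (intro mult_left_mono) auto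
        finally have "a < ennreal (real (Suc n) * (h n s)\<^sup>2)" using b by (simp add: ennreal_less_iff)
        then show ?thesis by (simp add: E_def add_increasing less_le_trans)
      qed
    qed
  qed
  have "(\<integral>\<^sup>+x. j (f x) \<partial>\<nu>) \<le> (\<integral>\<^sup>+x. liminf (\<lambda>n. E n (f x)) \<partial>\<nu>)"
    by (intro nn_integral_mono lim)
  also have "\<dots> \<le> liminf (\<lambda>n. \<integral>\<^sup>+x. E n (f x) \<partial>\<nu>)"
    by (intro nn_integral_liminf) measurable
  also have "\<dots> \<le> (\<integral>\<^sup>+x. j (f x + lam * g x) \<partial>\<nu>)"
    using bound by (intro Liminf_le) (auto intro: always_eventually)
  finally show ?thesis .
qed

text \<open>The subgradient inequality at \<open>u1\<close> is tested with \<open>u1 - h\<close> and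
  the one at \<open>u2\<close> with \<open>u2 + h\<close>. In the sum the finite energies cancel by
  \<open>le\<close>, leaving only the pairings.\<close>

lemma subdiff_test_nonneg:
  assumes 1: "subdiff \<nu> F u1 v1" and 2: "subdiff \<nu> F u2 v2"
    and nn: "\<And>u. 0 \<le> F u"
    and h: "sqint \<nu> (\<lambda>x. h (u1 x - u2 x))"
    and le: "F (\<lambda>x. u1 x - h (u1 x - u2 x)) + F (\<lambda>x. u2 x + h (u1 x - u2 x)) \<le> F u1 + F u2"
  shows "0 \<le> (\<integral>x. (v1 x - v2 x) * h (u1 x - u2 x) \<partial>\<nu>)"
proof -
  let ?h = "\<lambda>x. h (u1 x - u2 x)"
  have sq: "sqint \<nu> u1" "sqint \<nu> u2" "sqint \<nu> v1" "sqint \<nu> v2"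
    using 1 2 by (auto simp: subdiff_def)
  obtain a b where a: "F u1 = ereal a" and b: "F u2 = ereal b"
    using 1 2 nn[of u1] nn[of u2] by (cases "F u1"; cases "F u2") (auto simp: subdiff_def)
  have i1: "integrable \<nu> (\<lambda>x. v1 x * ?h x)" and i2: "integrable \<nu> (\<lambda>x. v2 x * ?h x)"
    using sq h by (auto intro: sqint_mult_integrable)
  have "F u1 + ereal (\<integral>x. v1 x * ((u1 x - ?h x) - u1 x) \<partial>\<nu>) \<le> F (\<lambda>x. u1 x - ?h x)"
    using 1 sqint_diff[OF sq(1) h] unfolding subdiff_def by blast
  moreover have "F u2 + ereal (\<integral>x. v2 x * ((u2 x + ?h x) - u2 x) \<partial>\<nu>) \<le> F (\<lambda>x. u2 x + ?h x)"
    using 2 sqint_add[OF sq(2) h] unfolding subdiff_def by blast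
  ultimately have "F u1 + ereal (\<integral>x. v1 x * ((u1 x - ?h x) - u1 x) \<partial>\<nu>) +
      (F u2 + ereal (\<integral>x. v2 x * ((u2 x + ?h x) - u2 x) \<partial>\<nu>)) \<le> F u1 + F u2"
    using le by (meson add_mono order_trans)
  then have "(\<integral>x. v2 x * ?h x \<partial>\<nu>) \<le> (\<integral>x. v1 x * ?h x \<partial>\<nu>)"
    by (simp add: a b)
  then show ?thesis
    using i1 i2 by (simp add: left_diff_distrib)
qed

section \<open>Perturbation of the energies\<close>

text \<open>Testing with the sign of \<open>g\<close> on the part of
  \<open>{\<bar>g\<bar> > 1}\<close> inside a set of finite measure shows that
  \<open>\<bar>g\<bar> - 1\<close>, positive there, has integral at most 0. That part is therefore
  null.\<close>

lemma AE_abs_le_1I: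
  assumes "sigma_finite_measure \<nu>" and [measurable]: "g \<in> borel_measurable \<nu>"
    and int: "\<And>\<phi>. bounded_finite_support \<nu> \<phi> \<Longrightarrow> integrable \<nu> (\<lambda>x. g x * \<phi> x)"
    and le: "\<And>\<phi>. bounded_finite_support \<nu> \<phi> \<Longrightarrow> (\<integral>x. g x * \<phi> x \<partial>\<nu>) \<le> (\<integral>x. \<bar>\<phi> x\<bar> \<partial>\<nu>)"
  shows "AE x in \<nu>. \<bar>g x\<bar> \<le> (1::real)"
proof -
  interpret sigma_finite_measure \<nu> by fact
  obtain A :: "nat \<Rightarrow> 'a set" where A: "range A \<subseteq> sets \<nu>" "(\<Union>i. A i) = space \<nu>"
      "\<And>i. emeasure \<nu> (A i) \<noteq> \<infinity>"
    using sigma_finite by metis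
  have "AE x in \<nu>. x \<in> A i \<longrightarrow> \<bar>g x\<bar> \<le> 1" for i
  proof -
    have [measurable]: "A i \<in> sets \<nu>" using A by auto
    define S where "S = {x \<in> space \<nu>. x \<in> A i \<and> \<bar>g x\<bar> > 1}"
    have [measurable]: "S \<in> sets \<nu>" unfolding S_def by measurable
    define \<phi> where "\<phi> x = sgn (g x) * indicator S x" for x
    have [measurable]: "\<phi> \<in> borel_measurable \<nu>" unfolding \<phi>_def by measurable
    have "emeasure \<nu> {x \<in> space \<nu>. \<phi> x \<noteq> 0} \<le> emeasure \<nu> (A i)"
      by (intro emeasure_mono) (auto simp: \<phi>_def S_def indicator_def)
    also have "\<dots> < \<infinity>" using A(3) by (simp add: top.not_eq_extremum)
    finally have \<phi>: "bounded_finite_support \<nu> \<phi>"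
      by (auto simp: bounded_finite_support_def \<phi>_def indicator_def abs_sgn_eq intro!: exI[of _ 1])
    note i1 = int[OF \<phi>] and i2 = bounded_finite_support_integrable_abs[OF \<phi>]
    have eq: "g x * \<phi> x - \<bar>\<phi> x\<bar> = (\<bar>g x\<bar> - 1) * indicator S x" for x
      by (auto simp: \<phi>_def indicator_def S_def abs_mult sgn_if abs_if)
    have i3: "integrable \<nu> (\<lambda>x. (\<bar>g x\<bar> - 1) * indicator S x)"
      using Bochner_Integration.integrable_diff[OF i1 i2] by (simp add: eq)
    have nn: "0 \<le> (\<bar>g x\<bar> - 1) * indicator S x" for x
      by (auto simp: S_def indicator_def)
    have "(\<integral>x. (\<bar>g x\<bar> - 1) * indicator S x \<partial>\<nu>) \<le> 0"
      using le[OF \<phi>] Bochner_Integration.integral_diff[OF i1 i2] by (simp add: eq)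
    then have "(\<integral>x. (\<bar>g x\<bar> - 1) * indicator S x \<partial>\<nu>) = 0"
      using nn by (intro antisym integral_nonneg_AE) auto
    then have "AE x in \<nu>. (\<bar>g x\<bar> - 1) * indicator S x = 0"
      using i3 nn by (subst (asm) integral_nonneg_eq_0_iff_AE) auto
    then show ?thesis
      using AE_space by eventually_elim (auto simp: S_def indicator_def not_less split: if_splits)
  qed
  then have "AE x in \<nu>. \<forall>i. x \<in> A i \<longrightarrow> \<bar>g x\<bar> \<le> 1" by (subst AE_all_countable) blast
  then show ?thesis
    using AE_space by eventually_elim (use A(2) in blast)
qed

text \<open>\<open>L\<^sup>1 \<inter> (L\<^sup>2 + L\<^sup>\<infinity>) \<subseteq> L\<^sup>2\<close>: either \<open>\<bar>f\<bar> \<le> 2\<close> and \<open>f\<^sup>2 \<le> 2 \<bar>f\<bar>\<close>, or \<open>\<bar>f\<bar> \<le> 2 \<bar>a\<bar>\<close>.\<close>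

lemma sqint_of_integrable_near_sqint:
  assumes f: "integrable \<nu> f" and a: "sqint \<nu> a" and le: "AE x in \<nu>. \<bar>f x + a x\<bar> \<le> 1"
  shows "sqint \<nu> f"
proof (rule sqint_bound[where g="\<lambda>x. 2 * \<bar>f x\<bar> + 4 * (a x)\<^sup>2"])
  show "AE x in \<nu>. (f x)\<^sup>2 \<le> 2 * \<bar>f x\<bar> + 4 * (a x)\<^sup>2"
    using le
  proof eventually_elim
    case (elim x)
    show ?case
    proof (cases "\<bar>f x\<bar> \<le> 2")
      case True
      then have "\<bar>f x\<bar> * \<bar>f x\<bar> \<le> 2 * \<bar>f x\<bar>" by (intro mult_right_mono) auto
      moreover have "0 \<le> 4 * (a x)\<^sup>2" by simp
      ultimately show ?thesis unfolding power2_eq_square abs_mult_self_eq by linarith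
    next
      case False
      then have "\<bar>f x\<bar> \<le> \<bar>2 * a x\<bar>" using elim by linarith
      then have "(f x)\<^sup>2 \<le> (2 * a x)\<^sup>2" by (simp only: abs_le_square_iff)
      then show ?thesis by (simp add: power_mult_distrib)
    qed
  qed
qed (use f a in \<open>auto simp: sqint_def\<close>)

section \<open>Increments of the energies and integrability of the
  \<open>p\<close>-Laplacian\<close>

context reversible_walk
begin

lemma integral_fst:
  fixes f :: "'a \<Rightarrow> real"
  assumes "integrable \<nu> f"
  shows "(\<integral>q. f (fst q) \<partial>P) = (\<integral>x. f x \<partial>\<nu>)"
proof -
  have "(\<integral>q. f (fst q) \<partial>P) = (\<integral>x. (\<integral>y. f x \<partial>m x) \<partial>\<nu>)"
    using integrable_disintegrate(3)[OF integrable_fst[OF assms]] by simp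
  also have "\<dots> = (\<integral>x. f x \<partial>\<nu>)"
    by (intro Bochner_Integration.integral_cong)
       (auto simp: prob_space.prob_space[OF prob_space_kernel])
  finally show ?thesis .
qed

text \<open>Here \<open>u + t * w\<close> is the convex combination of \<open>u\<close> and
  \<open>u + w\<close>. This bounds the increment of the non-smooth 1-energy without differentiating
  it.\<close>

lemma energy_convex:
  assumes [measurable]: "u \<in> borel_measurable \<nu>" "w \<in> borel_measurable \<nu>"
    and "p \<ge> 1" "energy_finite p u" "energy_finite p w" and t: "0 \<le> t" "t \<le> 1"
  shows "energy p (\<lambda>x. u x + t * w x) \<le> (1 - t) * energy p u + t * energy p (\<lambda>x. u x + w x)"
proof -
  have fin: "energy_finite p (\<lambda>x. u x + t * w x)" "energy_finite p (\<lambda>x. u x + w x)"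
    using assms energy_finite_add[of u w p t] energy_finite_add[of u w p 1] by auto
  have pt: "\<bar>grad (\<lambda>x. u x + t * w x) q\<bar> powr p
      \<le> (1 - t) * \<bar>grad u q\<bar> powr p + t * \<bar>grad (\<lambda>x. u x + w x) q\<bar> powr p" for q
    using powr_abs_convex[OF \<open>p \<ge> 1\<close> t, of "grad u q" "grad (\<lambda>x. u x + w x) q"]
    by (simp add: grad_def algebra_simps)
  have "(\<integral>q. \<bar>grad (\<lambda>x. u x + t * w x) q\<bar> powr p \<partial>P) \<le>
      (\<integral>q. (1 - t) * \<bar>grad u q\<bar> powr p + t * \<bar>grad (\<lambda>x. u x + w x) q\<bar> powr p \<partial>P)"
    using assms fin pt by (intro integral_mono) (auto simp: energy_finite_def)
  also have "\<dots> = (1 - t) * (\<integral>q. \<bar>grad u q\<bar> powr p \<partial>P) + t * (\<integral>q. \<bar>grad (\<lambda>x. u x + w x) q\<bar> powr p \<partial>P)"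
    using assms fin by (simp add: energy_finite_def)
  finally have "(\<integral>q. \<bar>grad (\<lambda>x. u x + t * w x) q\<bar> powr p \<partial>P) / (2 * p) \<le> ((1 - t) * (\<integral>q. \<bar>grad u q\<bar> powr p \<partial>P) +
      t * (\<integral>q. \<bar>grad (\<lambda>x. u x + w x) q\<bar> powr p \<partial>P)) / (2 * p)"
    using \<open>p \<ge> 1\<close> by (intro divide_right_mono) auto
  then show ?thesis
    by (simp add: energy_def add_divide_distrib)
qed

text \<open>The tangent inequality is taken at the perturbed point \<open>u + t * w\<close> and
  evaluated at \<open>u\<close>, which yields an upper bound for the increment.\<close>

lemma energy_add_le:
  assumes [measurable]: "u \<in> borel_measurable \<nu>" "w \<in> borel_measurable \<nu>"
    and "p \<ge> 1" "energy_finite p u" "energy_finite p w"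
  shows "energy p (\<lambda>x. u x + t * w x) \<le>
     energy p u + t * ((\<integral>q. pflux p (grad u q + t * grad w q) * grad w q \<partial>P) / 2)"
proof -
  have fin: "energy_finite p (\<lambda>x. u x + t * w x)"
    using assms by (intro energy_finite_add) auto
  have int: "integrable P (\<lambda>q. pflux p (grad u q + t * grad w q) * grad w q)"
    using integrable_pflux_mult[of "\<lambda>x. u x + t * w x" "grad w" p] assms fin
    by (simp add: grad_add energy_finite_def)
  have "(\<integral>q. \<bar>grad (\<lambda>x. u x + t * w x) q\<bar> powr p \<partial>P) \<le>
      (\<integral>q. \<bar>grad u q\<bar> powr p + p * t * (pflux p (grad u q + t * grad w q) * grad w q) \<partial>P)"
  proof (rule integral_mono)
    fix q
    show "\<bar>grad (\<lambda>x. u x + t * w x) q\<bar> powr p \<le>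
        \<bar>grad u q\<bar> powr p + p * t * (pflux p (grad u q + t * grad w q) * grad w q)"
      using powr_abs_gradient_ineq[OF \<open>p \<ge> 1\<close>, of "grad u q + t * grad w q" "grad u q"]
      by (simp add: grad_add algebra_simps)
  qed (use assms fin int in \<open>auto simp: energy_finite_def\<close>)
  also have "\<dots> = (\<integral>q. \<bar>grad u q\<bar> powr p \<partial>P) +
      p * t * (\<integral>q. pflux p (grad u q + t * grad w q) * grad w q \<partial>P)"
    using assms int by (simp add: energy_finite_def)
  finally have "(\<integral>q. \<bar>grad (\<lambda>x. u x + t * w x) q\<bar> powr p \<partial>P) / (2 * p) \<le> ((\<integral>q. \<bar>grad u q\<bar> powr p \<partial>P) +
      p * t * (\<integral>q. pflux p (grad u q + t * grad w q) * grad w q \<partial>P)) / (2 * p)"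
    using \<open>p \<ge> 1\<close> by (intro divide_right_mono) auto
  then show ?thesis
    using \<open>p \<ge> 1\<close> by (simp add: energy_def add_divide_distrib)
qed

text \<open>The flux is continuous for \<open>p > 1\<close>, and the step sizes are at most 1, so
  one majorant serves all \<open>n\<close>.\<close>

lemma energy_derivative_LIMSEQ:
  assumes [measurable]: "u \<in> borel_measurable \<nu>" "w \<in> borel_measurable \<nu>"
    and "p > 1" "energy_finite p u" "energy_finite p w"
  shows "(\<lambda>n. \<integral>q. pflux p (grad u q + 1 / real (Suc n) * grad w q) * grad w q \<partial>P)
    \<longlonglongrightarrow> (\<integral>q. pflux p (grad u q) * grad w q \<partial>P)"
proof (rule integral_dominated_convergence)
  show "integrable P (\<lambda>q. 2 powr p * (\<bar>grad u q\<bar> powr p + \<bar>grad w q\<bar> powr p) + \<bar>grad w q\<bar> powr p)"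
    using assms by (simp add: energy_finite_def)
  show "AE q in P. norm (pflux p (grad u q + 1 / real (Suc n) * grad w q) * grad w q) \<le>
      2 powr p * (\<bar>grad u q\<bar> powr p + \<bar>grad w q\<bar> powr p) + \<bar>grad w q\<bar> powr p" for n
  proof (rule AE_I2)
    fix q
    define t where "t = 1 / real (Suc n)"
    have t: "0 \<le> t" "t \<le> 1" by (auto simp: t_def)
    have "norm (pflux p (grad u q + t * grad w q) * grad w q) \<le>
        \<bar>grad u q + t * grad w q\<bar> powr p + \<bar>grad w q\<bar> powr p"
      using powr_mult_abs_le[of p] \<open>p > 1\<close> by (simp add: abs_mult abs_pflux)
    also have "\<bar>grad u q + t * grad w q\<bar> powr p \<le> 2 powr p * (\<bar>grad u q\<bar> powr p + \<bar>t * grad w q\<bar> powr p)"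
      using \<open>p > 1\<close> by (intro powr_abs_add_le) auto
    also have "\<bar>t * grad w q\<bar> powr p \<le> \<bar>grad w q\<bar> powr p"
      using t \<open>p > 1\<close> by (intro powr_mono2) (auto simp: abs_mult mult_left_le_one_le)
    finally show "norm (pflux p (grad u q + 1 / real (Suc n) * grad w q) * grad w q) \<le>
        2 powr p * (\<bar>grad u q\<bar> powr p + \<bar>grad w q\<bar> powr p) + \<bar>grad w q\<bar> powr p"
      by (simp add: t_def)
  qed
  show "AE q in P. (\<lambda>n. pflux p (grad u q + 1 / real (Suc n) * grad w q) * grad w q)
      \<longlonglongrightarrow> pflux p (grad u q) * grad w q"
  proof (rule AE_I2)
    fix q
    have "(\<lambda>n. grad u q + 1 / real (Suc n) * grad w q) \<longlonglongrightarrow> grad u q + 0 * grad w q"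
      by (intro tendsto_intros LIMSEQ_Suc[OF lim_1_over_n])
    then have "(\<lambda>n. pflux p (grad u q + 1 / real (Suc n) * grad w q)) \<longlonglongrightarrow> pflux p (grad u q)"
      using pflux_isCont[OF \<open>p > 1\<close>] by (intro isCont_tendsto_compose[where g="pflux p"]) auto
    then show "(\<lambda>n. pflux p (grad u q + 1 / real (Suc n) * grad w q) * grad w q)
        \<longlonglongrightarrow> pflux p (grad u q) * grad w q"
      by (intro tendsto_intros)
  qed
qed measurable

text \<open>By the triangle inequality the increment is at most half the sum of the two endpoint
  integrals of \<open>\<bar>w\<bar>\<close>. Both equal the integral over \<open>\<nu>\<close>, by
  swapping and by the first marginal.\<close>

lemma energy_1_add_le:
  assumes [measurable]: "u \<in> borel_measurable \<nu>" and u: "energy_finite 1 u" and w: "bounded_finite_support \<nu> w"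
  shows "energy 1 (\<lambda>x. u x + w x) \<le> energy 1 u + (\<integral>x. \<bar>w x\<bar> \<partial>\<nu>)"
proof -
  have [measurable]: "w \<in> borel_measurable \<nu>" using w by (rule bounded_finite_support_measurable)
  have wi: "integrable \<nu> (\<lambda>x. \<bar>w x\<bar>)" using w by (rule bounded_finite_support_integrable_abs)
  have i1: "integrable P (\<lambda>q. \<bar>grad u q\<bar>)" using u by (simp add: energy_finite_def)
  have i2: "integrable P (\<lambda>q. \<bar>w (fst q)\<bar>)" and i3: "integrable P (\<lambda>q. \<bar>w (snd q)\<bar>)"
    using integrable_fst[OF wi] integrable_snd[OF wi] by auto
  have "energy_finite 1 (\<lambda>x. u x + w x)"
    using energy_finite_add[of u w 1 1] u bounded_finite_support_energy_finite[OF w] by simp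
  then have "(\<integral>q. \<bar>grad (\<lambda>x. u x + w x) q\<bar> \<partial>P) \<le> (\<integral>q. \<bar>grad u q\<bar> + \<bar>w (fst q)\<bar> + \<bar>w (snd q)\<bar> \<partial>P)"
    using i1 i2 i3 by (intro integral_mono) (auto simp: energy_finite_def grad_def)
  also have "\<dots> = (\<integral>q. \<bar>grad u q\<bar> \<partial>P) + (\<integral>q. \<bar>w (fst q)\<bar> \<partial>P) + (\<integral>q. \<bar>w (snd q)\<bar> \<partial>P)"
    using i1 i2 i3 by simp
  also have "(\<integral>q. \<bar>w (snd q)\<bar> \<partial>P) = (\<integral>q. \<bar>w (fst q)\<bar> \<partial>P)"
    using integral_swap[of "\<lambda>q. \<bar>w (fst q)\<bar>"] by simp
  also have "(\<integral>q. \<bar>w (fst q)\<bar> \<partial>P) = (\<integral>x. \<bar>w x\<bar> \<partial>\<nu>)"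
    using integral_fst[OF wi] .
  finally show ?thesis by (simp add: energy_def)
qed

lemma energy_1_trunc_LIMSEQ:
  assumes [measurable]: "u \<in> borel_measurable \<nu>" "w \<in> borel_measurable \<nu>"
    and "energy_finite 1 u" "energy_finite 1 w"
  shows "(\<lambda>n. energy 1 (\<lambda>x. u x + trunc n (w x))) \<longlonglongrightarrow> energy 1 (\<lambda>x. u x + w x)"
  unfolding energy_def
proof (intro tendsto_divide tendsto_const integral_dominated_convergence[where w="\<lambda>q. \<bar>grad u q\<bar> + \<bar>grad w q\<bar>"])
  have eq: "grad (\<lambda>x. u x + f x) q = grad u q + grad f q" for f :: "'a \<Rightarrow> real" and q
    by (simp add: grad_def)
  show "integrable P (\<lambda>q. \<bar>grad u q\<bar> + \<bar>grad w q\<bar>)"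
    using assms by (simp add: energy_finite_def)
  show "AE q in P. norm (\<bar>grad (\<lambda>x. u x + trunc n (w x)) q\<bar> powr 1) \<le> \<bar>grad u q\<bar> + \<bar>grad w q\<bar>" for n
    unfolding eq using abs_grad_trunc_le[of n w] by (auto intro!: AE_I2 abs_triangle_ineq[THEN order_trans])
  show "AE q in P. (\<lambda>n. \<bar>grad (\<lambda>x. u x + trunc n (w x)) q\<bar> powr 1)
      \<longlonglongrightarrow> \<bar>grad (\<lambda>x. u x + w x) q\<bar> powr 1"
    unfolding eq by (auto intro!: AE_I2 tendsto_intros grad_trunc_LIMSEQ)
qed auto

text \<open>The flux is split at \<open>\<bar>grad u\<bar> = 1\<close>: for \<open>p \<ge> 2\<close> it is dominated by \<open>\<bar>grad u\<bar>\<close> below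
  and by \<open>\<bar>grad u\<bar> powr p\<close> above.\<close>

lemma lap_split:
  assumes u: "sqint \<nu> u" and "p \<ge> 2" "energy_finite p u"
  obtains a b where "sqint \<nu> a" "integrable \<nu> b" "AE x in \<nu>. lap p u x = a x + b x"
proof -
  have [measurable]: "u \<in> borel_measurable \<nu>" using u by (rule sqint_measurable)
  define za where "za q = (if \<bar>grad u q\<bar> \<le> 1 then pflux p (grad u q) else 0)" for q
  define zb where "zb q = (if \<bar>grad u q\<bar> \<le> 1 then 0 else pflux p (grad u q))" for q
  have [measurable]: "za \<in> borel_measurable P" "zb \<in> borel_measurable P"
    unfolding za_def zb_def by measurable
  have u2: "integrable \<nu> (\<lambda>x. (u x)\<^sup>2)" using u by (simp add: sqint_def)
  have za1: "\<bar>za q\<bar> \<le> \<bar>grad u q\<bar>" for q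
  proof (cases "\<bar>grad u q\<bar> \<le> 1 \<and> grad u q \<noteq> 0")
    case True
    then have "\<bar>grad u q\<bar> powr (p - 1) \<le> \<bar>grad u q\<bar> powr 1"
      using \<open>p \<ge> 2\<close> by (intro powr_mono') auto
    with True show ?thesis by (simp add: za_def abs_pflux)
  qed (auto simp: za_def pflux_def)
  have za_1: "\<bar>za q\<bar> \<le> 1" for q
    using za1[of q] by (auto simp: za_def split: if_splits)
  have za2: "integrable P (\<lambda>q. (za q)\<^sup>2)"
  proof (rule Bochner_Integration.integrable_bound)
    show "integrable P (\<lambda>q. 2 * (u (snd q))\<^sup>2 + 2 * (u (fst q))\<^sup>2)"
      using integrable_fst[OF u2] integrable_snd[OF u2] by simp
    show "AE q in P. norm ((za q)\<^sup>2) \<le> norm (2 * (u (snd q))\<^sup>2 + 2 * (u (fst q))\<^sup>2)"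
    proof (rule AE_I2)
      fix q
      have "(za q)\<^sup>2 \<le> (grad u q)\<^sup>2" using za1[of q] by (simp add: abs_le_square_iff)
      also have "\<dots> \<le> 2 * (u (snd q))\<^sup>2 + 2 * (u (fst q))\<^sup>2"
        using sum_squares_bound[of "u (snd q)" "- u (fst q)"] by (simp add: grad_def power2_diff)
      finally show "norm ((za q)\<^sup>2) \<le> norm (2 * (u (snd q))\<^sup>2 + 2 * (u (fst q))\<^sup>2)" by simp
    qed
  qed measurable
  have zb: "integrable P zb"
  proof (rule Bochner_Integration.integrable_bound)
    show "integrable P (\<lambda>q. \<bar>grad u q\<bar> powr p)" using assms by (simp add: energy_finite_def)
    show "AE q in P. norm (zb q) \<le> norm (\<bar>grad u q\<bar> powr p)"
      by (auto intro!: AE_I2 powr_mono simp: zb_def abs_pflux)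
  qed measurable
  define a where "a x = (\<integral>y. za (x, y) \<partial>m x)" for x
  define b where "b x = (\<integral>y. zb (x, y) \<partial>m x)" for x
  have [measurable]: "a \<in> borel_measurable \<nu>"
    unfolding a_def by (rule integral_kernel_measurable) measurable
  have za_meas: "(\<lambda>y. za (x, y)) \<in> borel_measurable (m x)" if "x \<in> space \<nu>" for x
    using that by (simp add: measurable_kernel_iff) measurable
  have za_int: "integrable (m x) (\<lambda>y. za (x, y))" "integrable (m x) (\<lambda>y. (za (x, y))\<^sup>2)" if "x \<in> space \<nu>" for x
  proof -
    interpret prob_space "m x" using that by (rule prob_space_kernel)
    note za_meas[OF that, measurable]
    show "integrable (m x) (\<lambda>y. za (x, y))"
      by (rule integrable_const_bound[where B=1]) (auto simp: za_1)
    show "integrable (m x) (\<lambda>y. (za (x, y))\<^sup>2)"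
      by (rule integrable_const_bound[where B=1]) (auto simp: za_1 abs_square_le_1)
  qed
  show ?thesis
  proof (rule that)
    show "integrable \<nu> b" unfolding b_def by (rule integrable_disintegrate(2)[OF zb])
    show "sqint \<nu> a"
    proof (rule sqint_bound[OF integrable_disintegrate(2)[OF za2]])
      show "AE x in \<nu>. (a x)\<^sup>2 \<le> (\<integral>y. (za (x, y))\<^sup>2 \<partial>m x)"
      proof (rule AE_I2)
        fix x assume x: "x \<in> space \<nu>"
        interpret prob_space "m x" using x by (rule prob_space_kernel)
        \<comment> \<open>Jensen's inequality for the square, in the form that the variance under
          \<open>m x\<close> is nonnegative.\<close>
        show "(a x)\<^sup>2 \<le> (\<integral>y. (za (x, y))\<^sup>2 \<partial>m x)"
          using variance_positive[of "\<lambda>y. za (x, y)"] variance_eq[OF za_int[OF x]] by (simp add: a_def)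
      qed
    qed measurable
    show "AE x in \<nu>. lap p u x = a x + b x"
      using integrable_disintegrate(1)[OF zb] AE_space
    proof eventually_elim
      case (elim x)
      have "lap p u x = (\<integral>y. za (x, y) + zb (x, y) \<partial>m x)"
        unfolding lap_def by (rule Bochner_Integration.integral_cong) (auto simp: za_def zb_def)
      also have "\<dots> = a x + b x"
        unfolding a_def b_def using za_int elim by (intro Bochner_Integration.integral_add) auto
      finally show ?case .
    qed
  qed
qed

end

section \<open>Two walks with comparable measures\<close>

text \<open>The Radon-Nikodym derivative enters as a real density that is nonnegative everywhere, so
  that integrals over \<open>\<nu>2\<close> can be rewritten as weighted integrals over
  \<open>\<nu>1\<close>.\<close>

locale comparable_walks =
  W1: reversible_walk m1 \<nu>1 + W2: reversible_walk m2 \<nu>2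
  for m1 m2 :: "'a \<Rightarrow> 'a measure" and \<nu>1 \<nu>2 :: "'a measure" +
  fixes p c C :: real and \<mu> :: "'a \<Rightarrow> real"
  assumes p: "p > 1" and sets_eq: "sets \<nu>2 = sets \<nu>1"
    and \<mu>_measurable [measurable]: "\<mu> \<in> borel_measurable \<nu>1"
    and \<nu>2_density: "\<nu>2 = density \<nu>1 (\<lambda>x. ennreal (\<mu> x))"
    and \<mu>_nonneg: "\<And>x. 0 \<le> \<mu> x" and c: "c > 0"
    and \<mu>_lower: "AE x in \<nu>1. c \<le> \<mu> x" and \<mu>_upper: "AE x in \<nu>1. \<mu> x \<le> C"
begin

section \<open>Transfer between \<open>\<nu>1\<close> and \<open>\<nu>2\<close>\<close>

lemma measurable_\<nu>2 [simp]: "measurable \<nu>2 N = measurable \<nu>1 N"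
  by (rule measurable_cong_sets) (auto simp: sets_eq)

lemma space_\<nu>2: "space \<nu>2 = space \<nu>1"
  using sets_eq by (rule sets_eq_imp_space_eq)

lemma integrable_\<nu>2_iff:
  fixes f :: "'a \<Rightarrow> real"
  assumes [measurable]: "f \<in> borel_measurable \<nu>1"
  shows "integrable \<nu>2 f \<longleftrightarrow> integrable \<nu>1 (\<lambda>x. \<mu> x * f x)"
  unfolding \<nu>2_density using \<mu>_nonneg by (subst integrable_density) auto

lemma integral_\<nu>2:
  fixes f :: "'a \<Rightarrow> real"
  assumes [measurable]: "f \<in> borel_measurable \<nu>1"
  shows "(\<integral>x. f x \<partial>\<nu>2) = (\<integral>x. \<mu> x * f x \<partial>\<nu>1)"
  unfolding \<nu>2_density using \<mu>_nonneg by (subst integral_density) auto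

text \<open>The density is bounded below by \<open>c > 0\<close>, so null sets of
  \<open>\<nu>2\<close> are null for \<open>\<nu>1\<close>.\<close>

lemma AE_\<nu>1_if_AE_\<nu>2:
  assumes "AE x in \<nu>2. Q x" shows "AE x in \<nu>1. Q x"
proof -
  have "AE x in \<nu>1. 0 < ennreal (\<mu> x) \<longrightarrow> Q x"
    using assms unfolding \<nu>2_density by (subst (asm) AE_density) auto
  with \<mu>_lower show ?thesis by eventually_elim (use c in auto)
qed

lemma sqint_\<nu>2:
  assumes u: "sqint \<nu>1 u" shows "sqint \<nu>2 u"
proof -
  have [measurable]: "u \<in> borel_measurable \<nu>1" using u by (rule sqint_measurable)
  have "integrable \<nu>1 (\<lambda>x. \<mu> x * (u x)\<^sup>2)"
  proof (rule Bochner_Integration.integrable_bound)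
    show "integrable \<nu>1 (\<lambda>x. C * (u x)\<^sup>2)" using u by (simp add: sqint_def)
    show "AE x in \<nu>1. norm (\<mu> x * (u x)\<^sup>2) \<le> norm (C * (u x)\<^sup>2)"
      using \<mu>_upper
    proof eventually_elim
      case (elim x)
      then have "\<mu> x * (u x)\<^sup>2 \<le> C * (u x)\<^sup>2" by (intro mult_right_mono) auto
      then show ?case using \<mu>_nonneg[of x] elim by (simp add: abs_mult)
    qed
  qed measurable
  then show ?thesis by (simp add: sqint_def integrable_\<nu>2_iff)
qed

lemma sqint_\<mu>_mult:
  assumes w: "sqint \<nu>2 w" shows "sqint \<nu>1 (\<lambda>x. \<mu> x * w x)"
proof -
  have [measurable]: "w \<in> borel_measurable \<nu>1" using sqint_measurable[OF w] by simp
  show ?thesis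
  proof (rule sqint_bound)
    show "integrable \<nu>1 (\<lambda>x. C * (\<mu> x * (w x)\<^sup>2))"
      using w by (intro integrable_mult_right) (simp add: sqint_def integrable_\<nu>2_iff)
    show "AE x in \<nu>1. (\<mu> x * w x)\<^sup>2 \<le> C * (\<mu> x * (w x)\<^sup>2)"
      using \<mu>_upper
    proof eventually_elim
      case (elim x)
      then have "\<mu> x * (\<mu> x * (w x)\<^sup>2) \<le> C * (\<mu> x * (w x)\<^sup>2)"
        using \<mu>_nonneg[of x] by (intro mult_right_mono) auto
      then show ?case by (simp add: power2_eq_square mult_ac)
    qed
  qed measurable
qed

text \<open>The lower bound gives \<open>\<mu> * w^2 \<le> (\<mu> * w)^2 / c\<close>. This is how
  the \<open>p\<close>-Laplacian gets the square integrability with respect to \<open>\<nu>2\<close>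
  that \<open>Deltap\<close> demands.\<close>

lemma sqint_\<nu>2_if_\<mu>_mult:
  assumes [measurable]: "w \<in> borel_measurable \<nu>1" and w: "sqint \<nu>1 (\<lambda>x. \<mu> x * w x)"
  shows "sqint \<nu>2 w"
proof -
  have "integrable \<nu>1 (\<lambda>x. \<mu> x * (w x)\<^sup>2)"
  proof (rule Bochner_Integration.integrable_bound)
    show "integrable \<nu>1 (\<lambda>x. (\<mu> x * w x)\<^sup>2 / c)" using w by (simp add: sqint_def)
    show "AE x in \<nu>1. norm (\<mu> x * (w x)\<^sup>2) \<le> norm ((\<mu> x * w x)\<^sup>2 / c)"
      using \<mu>_lower
    proof eventually_elim
      case (elim x)
      then have "c * (\<mu> x * (w x)\<^sup>2) \<le> \<mu> x * (\<mu> x * (w x)\<^sup>2)"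
        using \<mu>_nonneg[of x] by (intro mult_right_mono) auto
      then show ?case using c \<mu>_nonneg[of x] by (simp add: power2_eq_square field_simps)
    qed
  qed measurable
  then show ?thesis by (simp add: sqint_def integrable_\<nu>2_iff)
qed

lemma bounded_finite_support_\<nu>2:
  assumes u: "bounded_finite_support \<nu>1 u" shows "bounded_finite_support \<nu>2 u"
proof -
  have [measurable]: "u \<in> borel_measurable \<nu>1" using u by (rule bounded_finite_support_measurable)
  let ?S = "{x \<in> space \<nu>1. u x \<noteq> 0}"
  have "emeasure \<nu>2 ?S = (\<integral>\<^sup>+x. ennreal (\<mu> x) * indicator ?S x \<partial>\<nu>1)"
    unfolding \<nu>2_density by (rule emeasure_density) measurable
  also have "\<dots> \<le> (\<integral>\<^sup>+x. ennreal C * indicator ?S x \<partial>\<nu>1)"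
    using \<mu>_upper by (intro nn_integral_mono_AE) (auto elim!: eventually_mono intro!: mult_right_mono ennreal_leI)
  also have "\<dots> = ennreal C * emeasure \<nu>1 ?S"
    by (rule nn_integral_cmult_indicator) measurable
  also have "\<dots> < \<infinity>"
    using u by (simp add: bounded_finite_support_def ennreal_mult_less_top)
  finally show ?thesis
    using u by (simp add: bounded_finite_support_def space_\<nu>2)
qed

section \<open>The subdifferential of the total energy\<close>

definition total :: "('a \<Rightarrow> real) \<Rightarrow> ereal" where
  "total u = F1 m1 \<nu>1 u + Fp p m2 \<nu>2 u"

lemma total_nonneg: "0 \<le> total u"
  by (simp add: total_def F1_def Fp_def)

lemma total_finite_iff:
  assumes "sqint \<nu>1 u"
  shows "total u \<noteq> \<infinity> \<longleftrightarrow> W1.energy_finite 1 u \<and> W2.energy_finite p u"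
  using assms p W1.Fp_finite_iff[of u 1] W2.Fp_finite_iff[of u p]
  by (auto simp: total_def sqint_measurable W1.F1_eq_Fp)

lemma total_eq_energy:
  assumes "sqint \<nu>1 u" "W1.energy_finite 1 u" "W2.energy_finite p u"
  shows "total u = ereal (W1.energy 1 u + W2.energy p u)"
  using assms p by (simp add: total_def W1.F1_eq_Fp W1.Fp_eq_energy W2.Fp_eq_energy sqint_measurable)

text \<open>Subgradients of the summands add up. The weight \<open>\<mu>\<close> in
  \<open>v2\<close> is exactly what turns the pairing over \<open>\<nu>2\<close> into one over
  \<open>\<nu>1\<close>.\<close>

lemma opA_imp_subdiff:
  assumes A: "opA p m1 \<nu>1 m2 \<nu>2 \<mu> u v"
  shows "subdiff \<nu>1 total u v"
proof -
  obtain v1 v2 w where u: "sqint \<nu>1 u" and v: "sqint \<nu>1 v" and v_eq: "v = (\<lambda>x. v1 x + v2 x)"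
    and D1: "subdiff \<nu>1 (F1 m1 \<nu>1) u v1" and Dp: "Deltap p m2 \<nu>2 u w"
    and v2: "AE x in \<nu>1. v2 x = - \<mu> x * w x"
    using A by (auto simp: opA_def Delta1_def)
  have [measurable]: "u \<in> borel_measurable \<nu>1" using u by (rule sqint_measurable)
  have um2: "u \<in> borel_measurable \<nu>2" by simp
  have lapm [measurable]: "W2.lap p u \<in> borel_measurable \<nu>1"
    using W2.lap_measurable[OF um2] by simp
  have fin: "W2.energy_finite p u"
    using Dp W2.energy_finite_iff_nn_integral[OF um2] by (simp add: Deltap_def)
  have w_eq: "AE x in \<nu>2. W2.lap p u x = w x"
    using Dp by (auto simp: Deltap_def W2.lap_eq elim!: eventually_mono)
  have lap: "sqint \<nu>2 (W2.lap p u)"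
    by (rule sqint_cong_AE[OF _ _ w_eq]) (use Dp in \<open>auto simp: Deltap_def\<close>)
  have v2_eq: "AE x in \<nu>1. v2 x = - (\<mu> x * W2.lap p u x)"
    using v2 AE_\<nu>1_if_AE_\<nu>2[OF w_eq] by eventually_elim simp
  have sv1: "sqint \<nu>1 v1" using D1 by (simp add: subdiff_def)
  have "sqint \<nu>1 (\<lambda>x. v x - v1 x)" using v sv1 by (rule sqint_diff)
  then have sv2: "sqint \<nu>1 v2" by (simp add: v_eq)
  have [measurable]: "v2 \<in> borel_measurable \<nu>1" using sv2 by (rule sqint_measurable)
  have Dp': "subdiff \<nu>2 (Fp p m2 \<nu>2) u (\<lambda>x. - W2.lap p u x)"
    using sqint_\<nu>2[OF u] p fin lap by (intro W2.Fp_subdiff_lap) auto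
  obtain a where a: "F1 m1 \<nu>1 u = ereal a"
    using D1 by (cases "F1 m1 \<nu>1 u") (auto simp: subdiff_def F1_def)
  obtain b where b: "Fp p m2 \<nu>2 u = ereal b"
    using Dp' by (cases "Fp p m2 \<nu>2 u") (auto simp: subdiff_def Fp_def)
  show ?thesis
    unfolding subdiff_def
  proof (intro conjI allI impI)
    show "total u \<noteq> \<infinity>" by (simp add: total_def a b)
    fix f assume f: "sqint \<nu>1 f"
    then have [measurable]: "f \<in> borel_measurable \<nu>1" by (rule sqint_measurable)
    have d: "sqint \<nu>1 (\<lambda>x. f x - u x)" using f u by (rule sqint_diff)
    have "(\<integral>x. v2 x * (f x - u x) \<partial>\<nu>1) = (\<integral>x. - W2.lap p u x * (f x - u x) \<partial>\<nu>2)"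
      using v2_eq
      by (subst integral_\<nu>2) (auto intro!: integral_cong_AE elim!: eventually_mono simp: algebra_simps)
    moreover have "(\<integral>x. v x * (f x - u x) \<partial>\<nu>1) =
        (\<integral>x. v1 x * (f x - u x) \<partial>\<nu>1) + (\<integral>x. v2 x * (f x - u x) \<partial>\<nu>1)"
      unfolding v_eq distrib_right
      using sqint_mult_integrable[OF sv1 d] sqint_mult_integrable[OF sv2 d]
      by (rule Bochner_Integration.integral_add)
    moreover have "F1 m1 \<nu>1 u + ereal (\<integral>x. v1 x * (f x - u x) \<partial>\<nu>1) \<le> F1 m1 \<nu>1 f"
      using D1 f by (simp add: subdiff_def)
    moreover have "Fp p m2 \<nu>2 u + ereal (\<integral>x. - W2.lap p u x * (f x - u x) \<partial>\<nu>2) \<le> Fp p m2 \<nu>2 f"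
      using Dp' sqint_\<nu>2[OF f] unfolding subdiff_def by blast
    ultimately show "total u + ereal (\<integral>x. v x * (f x - u x) \<partial>\<nu>1) \<le> total f"
      unfolding total_def a b using add_mono by (fastforce simp: algebra_simps)
  qed (use u v in auto)
qed

lemma subdiff_imp_ineq:
  assumes D: "subdiff \<nu>1 total u v" and \<phi>: "bounded_finite_support \<nu>1 \<phi>"
  shows "integrable \<nu>1 (\<lambda>x. (v x + \<mu> x * W2.lap p u x) * \<phi> x)"
    and "(\<integral>x. (v x + \<mu> x * W2.lap p u x) * \<phi> x \<partial>\<nu>1) \<le> W1.energy 1 (\<lambda>x. u x + \<phi> x) - W1.energy 1 u"
proof -
  have u: "sqint \<nu>1 u" and v: "sqint \<nu>1 v" and fin: "W1.energy_finite 1 u" "W2.energy_finite p u"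
    using D total_finite_iff[of u] by (auto simp: subdiff_def)
  have [measurable]: "u \<in> borel_measurable \<nu>1" using u by (rule sqint_measurable)
  have s\<phi>: "sqint \<nu>1 \<phi>" using \<phi> by (rule bounded_finite_support_sqint)
  have [measurable]: "\<phi> \<in> borel_measurable \<nu>1" using s\<phi> by (rule sqint_measurable)
  have m2: "u \<in> borel_measurable \<nu>2" "\<phi> \<in> borel_measurable \<nu>2" by auto
  have [measurable]: "W2.lap p u \<in> borel_measurable \<nu>1"
    using W2.lap_measurable[OF m2(1)] by simp
  have \<phi>2: "bounded_finite_support \<nu>2 \<phi>" using \<phi> by (rule bounded_finite_support_\<nu>2)
  have fin\<phi>: "W1.energy_finite 1 \<phi>" "W2.energy_finite p \<phi>"
    using W1.bounded_finite_support_energy_finite[OF \<phi>] W2.bounded_finite_support_energy_finite[OF \<phi>2] p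
    by auto
  note parts = W2.lap_by_parts_bounded[OF m2(1) less_imp_le[OF p] fin(2) \<phi>2]
  have i1: "integrable \<nu>1 (\<lambda>x. v x * \<phi> x)" using v s\<phi> by (rule sqint_mult_integrable)
  have i2: "integrable \<nu>1 (\<lambda>x. \<mu> x * (\<phi> x * W2.lap p u x))"
    using parts(2) by (subst (asm) integrable_\<nu>2_iff) auto
  have eq: "(v x + \<mu> x * W2.lap p u x) * \<phi> x = v x * \<phi> x + \<mu> x * (\<phi> x * W2.lap p u x)" for x
    by (simp add: algebra_simps)
  show "integrable \<nu>1 (\<lambda>x. (v x + \<mu> x * W2.lap p u x) * \<phi> x)"
    unfolding eq using i1 i2 by (rule Bochner_Integration.integrable_add)
  let ?R = "\<lambda>n. \<integral>q. pflux p (grad u q + 1 / real (Suc n) * grad \<phi> q) * grad \<phi> q \<partial>W2.P"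
  \<comment> \<open>Convexity charges the 1-energy with \<open>t\<close> times its full increment,
    so after division by \<open>t\<close> only the \<open>p\<close>-term still depends on
    \<open>n\<close>.\<close>
  have step: "(\<integral>x. v x * \<phi> x \<partial>\<nu>1) \<le> W1.energy 1 (\<lambda>x. u x + \<phi> x) - W1.energy 1 u + ?R n / 2" for n
  proof -
    define t where "t = 1 / real (Suc n)"
    have t: "0 < t" "t \<le> 1" by (auto simp: t_def)
    have su: "sqint \<nu>1 (\<lambda>x. u x + t * \<phi> x)" using u sqint_cmult[OF s\<phi>] by (rule sqint_add)
    have fin': "W1.energy_finite 1 (\<lambda>x. u x + t * \<phi> x)" "W2.energy_finite p (\<lambda>x. u x + t * \<phi> x)"
      using fin fin\<phi> p m2 by (auto intro!: W1.energy_finite_add W2.energy_finite_add)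
    have "total u + ereal (\<integral>x. v x * ((u x + t * \<phi> x) - u x) \<partial>\<nu>1) \<le> total (\<lambda>x. u x + t * \<phi> x)"
      using D su unfolding subdiff_def by blast
    moreover have "(\<integral>x. v x * ((u x + t * \<phi> x) - u x) \<partial>\<nu>1) = t * (\<integral>x. v x * \<phi> x \<partial>\<nu>1)"
      by (simp add: mult.left_commute)
    ultimately have "W1.energy 1 u + W2.energy p u + t * (\<integral>x. v x * \<phi> x \<partial>\<nu>1) \<le>
        W1.energy 1 (\<lambda>x. u x + t * \<phi> x) + W2.energy p (\<lambda>x. u x + t * \<phi> x)"
      using total_eq_energy[OF u fin] total_eq_energy[OF su fin'] by simp
    moreover have "W1.energy 1 (\<lambda>x. u x + t * \<phi> x) \<le>
        (1 - t) * W1.energy 1 u + t * W1.energy 1 (\<lambda>x. u x + \<phi> x)"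
      using fin fin\<phi> t by (intro W1.energy_convex) auto
    moreover have "W2.energy p (\<lambda>x. u x + t * \<phi> x) \<le> W2.energy p u + t * (?R n / 2)"
      using W2.energy_add_le[OF m2 less_imp_le[OF p] fin(2) fin\<phi>(2), of t] by (simp add: t_def)
    moreover have "(1 - t) * W1.energy 1 u = W1.energy 1 u - t * W1.energy 1 u"
      by (simp add: left_diff_distrib)
    ultimately have "t * (\<integral>x. v x * \<phi> x \<partial>\<nu>1) \<le>
        t * W1.energy 1 (\<lambda>x. u x + \<phi> x) - t * W1.energy 1 u + t * (?R n / 2)"
      by linarith
    then have "t * (\<integral>x. v x * \<phi> x \<partial>\<nu>1) \<le>
        t * (W1.energy 1 (\<lambda>x. u x + \<phi> x) - W1.energy 1 u + ?R n / 2)"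
      by (simp only: right_diff_distrib distrib_left)
    then show ?thesis using t by (simp only: mult_le_cancel_left_pos)
  qed
  have "(\<lambda>n. W1.energy 1 (\<lambda>x. u x + \<phi> x) - W1.energy 1 u + ?R n / 2) \<longlonglongrightarrow>
      W1.energy 1 (\<lambda>x. u x + \<phi> x) - W1.energy 1 u + (\<integral>q. pflux p (grad u q) * grad \<phi> q \<partial>W2.P) / 2"
    by (intro tendsto_intros W2.energy_derivative_LIMSEQ m2 p fin fin\<phi>) simp
  then have "(\<integral>x. v x * \<phi> x \<partial>\<nu>1) \<le>
      W1.energy 1 (\<lambda>x. u x + \<phi> x) - W1.energy 1 u + (\<integral>q. pflux p (grad u q) * grad \<phi> q \<partial>W2.P) / 2"
    using step by (intro LIMSEQ_le_const) auto
  moreover have "(\<integral>q. pflux p (grad u q) * grad \<phi> q \<partial>W2.P) / 2 = - (\<integral>x. \<mu> x * (\<phi> x * W2.lap p u x) \<partial>\<nu>1)"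
    unfolding parts(3) by (subst integral_\<nu>2) auto
  ultimately show "(\<integral>x. (v x + \<mu> x * W2.lap p u x) * \<phi> x \<partial>\<nu>1) \<le> W1.energy 1 (\<lambda>x. u x + \<phi> x) - W1.energy 1 u"
    unfolding eq Bochner_Integration.integral_add[OF i1 i2] by simp
qed

lemma subdiff_imp_opA:
  assumes D: "subdiff \<nu>1 total u v" and cases: "emeasure \<nu>1 (space \<nu>1) < \<infinity> \<or> p \<ge> 2"
  shows "opA p m1 \<nu>1 m2 \<nu>2 \<mu> u v"
proof -
  have u: "sqint \<nu>1 u" and v: "sqint \<nu>1 v" and fin: "W1.energy_finite 1 u" "W2.energy_finite p u"
    using D total_finite_iff[of u] by (auto simp: subdiff_def)
  have [measurable]: "u \<in> borel_measurable \<nu>1" "v \<in> borel_measurable \<nu>1"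
    using u v by (auto intro: sqint_measurable)
  have um2: "u \<in> borel_measurable \<nu>2" by simp
  have [measurable]: "W2.lap p u \<in> borel_measurable \<nu>1"
    using W2.lap_measurable[OF um2] by simp
  \<comment> \<open>The only candidate for the part of \<open>v\<close> belonging to the 1-energy,
    since the part of the smooth energy has to be \<open>- \<mu> * lap\<close>.\<close>
  define v1 where "v1 x = v x + \<mu> x * W2.lap p u x" for x
  have [measurable]: "v1 \<in> borel_measurable \<nu>1" unfolding v1_def by measurable
  note ineq = subdiff_imp_ineq[OF D, folded v1_def]
  have "(\<integral>x. v1 x * \<phi> x \<partial>\<nu>1) \<le> (\<integral>x. \<bar>\<phi> x\<bar> \<partial>\<nu>1)" if "bounded_finite_support \<nu>1 \<phi>" for \<phi>
    using ineq(2)[OF that] W1.energy_1_add_le[OF _ fin(1) that] by simp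
  then have v1_le: "AE x in \<nu>1. \<bar>v1 x\<bar> \<le> 1"
    by (intro AE_abs_le_1I W1.sigma_finite ineq(1)) auto
  have lap1: "sqint \<nu>1 (\<lambda>x. \<mu> x * W2.lap p u x)"
  proof (cases "p \<ge> 2")
    case True
    obtain a b where a: "sqint \<nu>2 a" and b: "integrable \<nu>2 b" and ab: "AE x in \<nu>2. W2.lap p u x = a x + b x"
      by (rule W2.lap_split[OF sqint_\<nu>2[OF u] True fin(2)])
    have [measurable]: "b \<in> borel_measurable \<nu>1" using borel_measurable_integrable[OF b] by simp
    have b1: "integrable \<nu>1 (\<lambda>x. \<mu> x * b x)" using b by (simp add: integrable_\<nu>2_iff)
    have ab1: "AE x in \<nu>1. \<mu> x * W2.lap p u x = \<mu> x * a x + \<mu> x * b x"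
      using AE_\<nu>1_if_AE_\<nu>2[OF ab] by eventually_elim (simp add: distrib_left)
    have a1: "sqint \<nu>1 (\<lambda>x. v x + \<mu> x * a x)"
      using v sqint_\<mu>_mult[OF a] by (rule sqint_add)
    \<comment> \<open>The integrable part \<open>\<mu> * b\<close> differs from \<open>v1\<close>,
      which is bounded by 1, by a square-integrable function.\<close>
    have "sqint \<nu>1 (\<lambda>x. \<mu> x * b x)"
    proof (rule sqint_of_integrable_near_sqint[OF b1 a1])
      show "AE x in \<nu>1. \<bar>\<mu> x * b x + (v x + \<mu> x * a x)\<bar> \<le> 1"
        using v1_le ab1 by eventually_elim (simp add: v1_def add_ac)
    qed
    then have "sqint \<nu>1 (\<lambda>x. \<mu> x * a x + \<mu> x * b x)" using sqint_\<mu>_mult[OF a] by (intro sqint_add)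
    then show ?thesis by (rule sqint_cong_AE) (use ab1 in auto)
  next
    case False
    with cases interpret finite_measure \<nu>1 by (intro finite_measureI) auto
    \<comment> \<open>With finite measure the bound by 1 suffices, and \<open>\<mu> * lap\<close> is
      \<open>v1 - v\<close>.\<close>
    have "sqint \<nu>1 v1"
    proof (rule sqint_bound)
      show "integrable \<nu>1 (\<lambda>x. 1)" by simp
      show "AE x in \<nu>1. (v1 x)\<^sup>2 \<le> 1" using v1_le by eventually_elim (simp add: abs_square_le_1)
    qed simp
    from sqint_diff[OF this v] show ?thesis by (simp add: v1_def)
  qed
  have sv1: "sqint \<nu>1 v1" unfolding v1_def using v lap1 by (rule sqint_add)
  have "subdiff \<nu>1 (F1 m1 \<nu>1) u v1"
    unfolding subdiff_def
  proof (intro conjI allI impI)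
    show "F1 m1 \<nu>1 u \<noteq> \<infinity>" using fin(1) by (simp add: W1.F1_eq_Fp W1.Fp_finite_iff)
    fix f assume f: "sqint \<nu>1 f"
    then have [measurable]: "f \<in> borel_measurable \<nu>1" by (rule sqint_measurable)
    show "F1 m1 \<nu>1 u + ereal (\<integral>x. v1 x * (f x - u x) \<partial>\<nu>1) \<le> F1 m1 \<nu>1 f"
    proof (cases "F1 m1 \<nu>1 f = \<infinity>")
      case False
      then have ff: "W1.energy_finite 1 f" by (simp add: W1.F1_eq_Fp W1.Fp_finite_iff)
      define \<phi> where "\<phi> x = f x - u x" for x
      have \<phi>: "sqint \<nu>1 \<phi>" unfolding \<phi>_def using f u by (rule sqint_diff)
      have [measurable]: "\<phi> \<in> borel_measurable \<nu>1" using \<phi> by (rule sqint_measurable)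
      have fin\<phi>: "W1.energy_finite 1 \<phi>"
        using W1.energy_finite_add[of f u 1 "-1"] ff fin(1) by (simp add: \<phi>_def[abs_def])
      have int: "integrable \<nu>1 (\<lambda>x. v1 x * \<phi> x)" using sv1 \<phi> by (rule sqint_mult_integrable)
      \<comment> \<open>The inequality is known for truncated directions; both of its sides
        converge, which gives it for every square-integrable direction of finite 1-energy.\<close>
      have lim1: "(\<lambda>n. \<integral>x. v1 x * trunc n (\<phi> x) \<partial>\<nu>1) \<longlonglongrightarrow> (\<integral>x. v1 x * \<phi> x \<partial>\<nu>1)"
        by (rule integral_dominated_convergence[where w="\<lambda>x. \<bar>v1 x * \<phi> x\<bar>"])
           (use integrable_abs[OF int] in \<open>auto intro!: AE_I2 tendsto_mult trunc_LIMSEQ mult_left_mono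
             abs_trunc_le simp: abs_mult\<close>)
      have lim2: "(\<lambda>n. W1.energy 1 (\<lambda>x. u x + trunc n (\<phi> x)) - W1.energy 1 u) \<longlonglongrightarrow>
          W1.energy 1 (\<lambda>x. u x + \<phi> x) - W1.energy 1 u"
        by (intro tendsto_intros W1.energy_1_trunc_LIMSEQ fin fin\<phi>) auto
      have "(\<integral>x. v1 x * \<phi> x \<partial>\<nu>1) \<le> W1.energy 1 (\<lambda>x. u x + \<phi> x) - W1.energy 1 u"
        by (rule LIMSEQ_le[OF lim1 lim2]) (use ineq(2) trunc_bounded_finite_support[OF \<phi>] in blast)
      moreover have "(\<lambda>x. u x + \<phi> x) = f" by (simp add: \<phi>_def)
      ultimately show ?thesis
        using fin(1) ff by (simp add: W1.F1_eq_Fp W1.Fp_eq_energy \<phi>_def)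
    qed simp
  qed (use u sv1 in auto)
  then have D1: "Delta1 m1 \<nu>1 u (\<lambda>x. - v1 x)" by (simp add: Delta1_def)
  have "sqint \<nu>2 (W2.lap p u)" using lap1 by (intro sqint_\<nu>2_if_\<mu>_mult) auto
  then have Dp: "Deltap p m2 \<nu>2 u (W2.lap p u)"
    using sqint_\<nu>2[OF u] fin(2) W2.energy_finite_iff_nn_integral[OF um2, of p]
    by (simp add: Deltap_def W2.lap_eq)
  show ?thesis
    unfolding opA_def
    using u v D1 Dp
    by (intro conjI exI[of _ v1] exI[of _ "\<lambda>x. - \<mu> x * W2.lap p u x"] exI[of _ "W2.lap p u"])
       (auto simp: v1_def)
qed

section \<open>Complete accretivity and density of the domain\<close>

text \<open>Both energies contract under the same \<open>h\<close>, hence so does their sum, and the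
  resulting sign of the pairing is the hypothesis of \<open>nn_integral_j_le\<close>.\<close>

lemma completely_accretive_subdiff: "completely_accretive \<nu>1 (subdiff \<nu>1 total)"
  unfolding completely_accretive_def
proof (intro allI impI, elim conjE)
  fix lam :: real and u1 v1 u2 v2 :: "'a \<Rightarrow> real" and j
  assume lam: "lam > 0" and D1: "subdiff \<nu>1 total u1 v1" and D2: "subdiff \<nu>1 total u2 v2"
    and j: "admissible_j j"
  have sq: "sqint \<nu>1 u1" "sqint \<nu>1 u2" "sqint \<nu>1 v1" "sqint \<nu>1 v2"
    using D1 D2 by (auto simp: subdiff_def)
  have [measurable]: "u1 \<in> borel_measurable \<nu>1" "u2 \<in> borel_measurable \<nu>1"
    using sq by (auto intro: sqint_measurable)
  have su: "sqint \<nu>1 (\<lambda>x. u1 x - u2 x)" and sv: "sqint \<nu>1 (\<lambda>x. v1 x - v2 x)"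
    using sq by (auto intro: sqint_diff)
  show "(\<integral>\<^sup>+ x. j (u1 x - u2 x) \<partial>\<nu>1) \<le> (\<integral>\<^sup>+ x. j (u1 x - u2 x + lam * (v1 x - v2 x)) \<partial>\<nu>1)"
  proof (rule nn_integral_j_le[OF su sv lam j])
    fix h :: "real \<Rightarrow> real"
    assume mono: "\<And>s t. s \<le> t \<Longrightarrow> 0 \<le> h t - h s \<and> h t - h s \<le> t - s" and h0: "h 0 = 0"
    have [measurable]: "h \<in> borel_measurable borel"
      using mono by (intro borel_measurable_mono monoI) (metis diff_ge_0_iff_ge)
    have habs: "\<bar>h s\<bar> \<le> \<bar>s\<bar>" for s
      using mono[of 0 s] mono[of s 0] h0 by (cases "s \<ge> 0") auto
    have sh: "sqint \<nu>1 (\<lambda>x. h (u1 x - u2 x))"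
      using su habs
      by (intro sqint_bound[where g="\<lambda>x. (u1 x - u2 x)\<^sup>2"]) (auto simp: sqint_def abs_le_square_iff)
    show "0 \<le> (\<integral>x. (v1 x - v2 x) * h (u1 x - u2 x) \<partial>\<nu>1)"
    proof (rule subdiff_test_nonneg[OF D1 D2 total_nonneg sh])
      let ?a = "\<lambda>x. u1 x - h (u1 x - u2 x)" and ?b = "\<lambda>x. u2 x + h (u1 x - u2 x)"
      have "F1 m1 \<nu>1 ?a + F1 m1 \<nu>1 ?b \<le> F1 m1 \<nu>1 u1 + F1 m1 \<nu>1 u2"
        unfolding W1.F1_eq_Fp using mono by (intro W1.Fp_contract) auto
      moreover have "Fp p m2 \<nu>2 ?a + Fp p m2 \<nu>2 ?b \<le> Fp p m2 \<nu>2 u1 + Fp p m2 \<nu>2 u2"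
        using mono p by (intro W2.Fp_contract) auto
      ultimately have "(F1 m1 \<nu>1 ?a + F1 m1 \<nu>1 ?b) + (Fp p m2 \<nu>2 ?a + Fp p m2 \<nu>2 ?b) \<le>
          (F1 m1 \<nu>1 u1 + F1 m1 \<nu>1 u2) + (Fp p m2 \<nu>2 u1 + Fp p m2 \<nu>2 u2)"
        by (rule add_mono)
      then show "total ?a + total ?b \<le> total u1 + total u2"
        by (simp add: total_def add_ac)
    qed
  qed
qed

lemma opA_bounded_finite_support:
  assumes u: "bounded_finite_support \<nu>1 u"
  shows "\<exists>v. opA p m1 \<nu>1 m2 \<nu>2 \<mu> u v"
proof -
  have u2: "bounded_finite_support \<nu>2 u" using u by (rule bounded_finite_support_\<nu>2)
  have su: "sqint \<nu>1 u" using u by (rule bounded_finite_support_sqint)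
  have um2: "u \<in> borel_measurable \<nu>2" using u2 by (rule bounded_finite_support_measurable)
  define v1 where "v1 x = - W1.lap 1 u x" for x
  define w where "w = W2.lap p u"
  have l1: "sqint \<nu>1 (W1.lap 1 u)"
    using u by (intro W1.sqint_lap_bounded_finite_support) auto
  have sw: "sqint \<nu>2 w"
    unfolding w_def using u2 p by (intro W2.sqint_lap_bounded_finite_support) auto
  have "subdiff \<nu>1 (Fp 1 m1 \<nu>1) u v1"
    unfolding v1_def using su u l1
    by (intro W1.Fp_subdiff_lap W1.bounded_finite_support_energy_finite) auto
  then have D1: "Delta1 m1 \<nu>1 u (\<lambda>x. - v1 x)"
    by (simp add: Delta1_def W1.F1_eq_Fp[abs_def])
  have Dp: "Deltap p m2 \<nu>2 u w"
    using sqint_\<nu>2[OF su] sw W2.energy_finite_iff_nn_integral[OF um2, of p]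
      W2.bounded_finite_support_energy_finite[OF u2, of p] p
    by (simp add: Deltap_def w_def W2.lap_eq)
  have "sqint \<nu>1 (\<lambda>x. v1 x - \<mu> x * w x)"
    unfolding v1_def using sqint_minus[OF l1] sqint_\<mu>_mult[OF sw] by (rule sqint_diff)
  then have "opA p m1 \<nu>1 m2 \<nu>2 \<mu> u (\<lambda>x. v1 x - \<mu> x * w x)"
    unfolding opA_def using su D1 Dp
    by (intro conjI exI[of _ v1] exI[of _ "\<lambda>x. - \<mu> x * w x"] exI[of _ w]) auto
  then show ?thesis by blast
qed

text \<open>The truncations of \<open>f\<close> lie in the domain. Their error is at most
  \<open>f\<close> in modulus, so it tends to 0 in mean square by dominated convergence.\<close>

lemma dense_domain_opA: "dense_domain \<nu>1 (opA p m1 \<nu>1 m2 \<nu>2 \<mu>)"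
  unfolding dense_domain_def
proof (intro allI impI)
  fix f \<epsilon> assume f: "sqint \<nu>1 f" and \<epsilon>: "(\<epsilon>::real) > 0"
  have [measurable]: "f \<in> borel_measurable \<nu>1" using f by (rule sqint_measurable)
  have lim: "(\<lambda>n. \<integral>x. (f x - trunc n (f x))\<^sup>2 \<partial>\<nu>1) \<longlonglongrightarrow> (\<integral>x. 0 \<partial>\<nu>1)"
  proof (rule integral_dominated_convergence)
    show "integrable \<nu>1 (\<lambda>x. (f x)\<^sup>2)" using f by (simp add: sqint_def)
    show "AE x in \<nu>1. norm ((f x - trunc n (f x))\<^sup>2) \<le> (f x)\<^sup>2" for n
      using abs_trunc_diff_le by (auto simp: abs_le_square_iff)
    have "(\<lambda>n. (f x - trunc n (f x))\<^sup>2) \<longlonglongrightarrow> (f x - f x)\<^sup>2" for x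
      by (intro tendsto_intros trunc_LIMSEQ)
    then show "AE x in \<nu>1. (\<lambda>n. (f x - trunc n (f x))\<^sup>2) \<longlonglongrightarrow> 0" by simp
  qed measurable
  then have "\<forall>\<^sub>F n in sequentially. (\<integral>x. (f x - trunc n (f x))\<^sup>2 \<partial>\<nu>1) < \<epsilon>"
    using \<epsilon> by (simp add: order_tendstoD(2))
  then obtain n where n: "(\<integral>x. (f x - trunc n (f x))\<^sup>2 \<partial>\<nu>1) < \<epsilon>"
    by (auto simp: eventually_sequentially)
  from opA_bounded_finite_support[OF trunc_bounded_finite_support[OF f, of n]]
  obtain v where "opA p m1 \<nu>1 m2 \<nu>2 \<mu> (\<lambda>x. trunc n (f x)) v" ..
  with n show "\<exists>u v. opA p m1 \<nu>1 m2 \<nu>2 \<mu> u v \<and> (\<integral>x. (f x - u x)\<^sup>2 \<partial>\<nu>1) < \<epsilon>"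
    by blast
qed

end

section \<open>Specialisation to the Radon-Nikodym derivative\<close>

theorem theorem3p1:
  fixes p c :: real and m1 m2 :: "'a \<Rightarrow> 'a measure" and \<nu>1 \<nu>2 :: "'a measure"
  defines "\<mu> \<equiv> (\<lambda>x. enn2real (RN_deriv \<nu>1 \<nu>2 x))"
  assumes p: "p > 1"
    and rws1: "rws m1 \<nu>1" and rev1: "reversible m1 \<nu>1"
    and rws2: "rws m2 \<nu>2" and rev2: "reversible m2 \<nu>2"
    and same_sets: "sets \<nu>2 = sets \<nu>1"
    and ac: "absolutely_continuous \<nu>1 \<nu>2"
    and Linf: "\<exists>C. AE x in \<nu>1. RN_deriv \<nu>1 \<nu>2 x \<le> ennreal C"
    and c: "c > 0" and lower: "AE x in \<nu>1. c \<le> \<mu> x"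
    and cases: "emeasure \<nu>1 (space \<nu>1) < \<infinity> \<or> (emeasure \<nu>1 (space \<nu>1) = \<infinity> \<and> p \<ge> 2)"
  shows "(\<forall>u v. subdiff \<nu>1 (\<lambda>w. F1 m1 \<nu>1 w + Fp p m2 \<nu>2 w) u v \<longleftrightarrow> opA p m1 \<nu>1 m2 \<nu>2 \<mu> u v)
         \<and> completely_accretive \<nu>1 (opA p m1 \<nu>1 m2 \<nu>2 \<mu>)
         \<and> dense_domain \<nu>1 (opA p m1 \<nu>1 m2 \<nu>2 \<mu>)"
proof -
  interpret W1: reversible_walk m1 \<nu>1 by unfold_locales fact+
  interpret W2: reversible_walk m2 \<nu>2 by unfold_locales fact+
  interpret sigma_finite_measure \<nu>1 by (rule W1.sigma_finite)
  obtain C where C: "AE x in \<nu>1. RN_deriv \<nu>1 \<nu>2 x \<le> ennreal C" using Linf ..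
  \<comment> \<open>Essential boundedness makes the derivative finite almost everywhere, so passing
    to reals changes it only on a null set.\<close>
  have RN: "AE x in \<nu>1. RN_deriv \<nu>1 \<nu>2 x = ennreal (\<mu> x)"
    using C by eventually_elim (auto simp: \<mu>_def le_less_trans)
  have \<mu>m: "\<mu> \<in> borel_measurable \<nu>1" unfolding \<mu>_def by measurable
  have "density \<nu>1 (\<lambda>x. ennreal (\<mu> x)) = density \<nu>1 (RN_deriv \<nu>1 \<nu>2)"
    using RN \<mu>m by (intro density_cong) (auto elim!: eventually_mono)
  also have "\<dots> = \<nu>2" using ac same_sets by (rule density_RN_deriv)
  finally have dens: "\<nu>2 = density \<nu>1 (\<lambda>x. ennreal (\<mu> x))" ..
  \<comment> \<open>For negative \<open>C\<close> the value \<open>ennreal C\<close> is 0, hence the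
    maximum with 0 in the real bound.\<close>
  have upper: "AE x in \<nu>1. \<mu> x \<le> max C 0"
    using C unfolding \<mu>_def by eventually_elim (auto intro!: enn2real_leI)
  interpret comparable_walks m1 m2 \<nu>1 \<nu>2 p c "max C 0" \<mu>
    by unfold_locales (rule p same_sets \<mu>m dens c lower upper | simp add: \<mu>_def)+
  have total: "total = (\<lambda>w. F1 m1 \<nu>1 w + Fp p m2 \<nu>2 w)"
    by (simp add: total_def fun_eq_iff)
  \<comment> \<open>As an equality of relations it carries complete accretivity from the
    subdifferential to the operator.\<close>
  have eq: "subdiff \<nu>1 total = opA p m1 \<nu>1 m2 \<nu>2 \<mu>"
    using opA_imp_subdiff subdiff_imp_opA cases by (intro ext iffI) auto
  show ?thesis
    using completely_accretive_subdiff dense_domain_opA unfolding eq total[symmetric] by simp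
qed

end
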